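(* Let $\mathcal{H}$ be a complex Hilbert space, let $T\in \boldsymbol{B}(\mathcal{H})$ be a selfadjoint operator, let $F\colon \mathfrak{B}(\mathbb{R}) \to \boldsymbol{B}(\mathcal{H})$ be a semispectral measure with compact support, and let $p,q$ be positive integers such that $p<q$, $p$ is odd and $q$ is even. Then the following conditions are equivalent: (i) $F$ is the spectral measure of $T$; (ii) $T^k =\int_{\mathbb{R}} x^k F(\mathrm{d} x)$ for all integers $k\geqslant 0$; (iii) $T^k =\int_{\mathbb{R}} x^k F(\mathrm{d} x)$ for $k=p$ and $k=q$.
   Context: $\boldsymbol{B}(\mathcal{H})$ denotes the algebra of all bounded linear operators on $\mathcal{H}$, $I$ the identity operator on $\mathcal{H}$, and $\mathfrak{B}(\mathbb{R})$ the $\sigma$-algebra of Borel subsets of $\mathbb{R}$. A map $F\colon \mathfrak{B}(\mathbb{R})\to\boldsymbol{B}(\mathcal{H})$ is a semispectral measure if $\langle F(\cdot)h,h\rangle$ is a positive measure for every $h\in\mathcal{H}$ and $F(\mathbb{R})=I$; it is a spectral measure if in addition $F(\varDelta)$ is an orthogonal projection for every $\varDelta\in\mathfrak{B}(\mathbb{R})$. "Compact support" refers to the closed support of $F$. For a semispectral measure $F$ and a Borel function $f\colon\mathbb{R}\to\mathbb{C}$ with $\int_{\mathbb{R}}|f(x)|\langle F(\mathrm{d}x)h,h\rangle<\infty$ for all $h\in\mathcal{H}$, $\int_{\mathbb{R}} f\,\mathrm{d}F=\int_{\mathbb{R}} f(x)F(\mathrm{d}x)$ is the unique operator in $\boldsymbol{B}(\mathcal{H})$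 such that $\langle \int_{\mathbb{R}} f\,\mathrm{d}F\, h,h\rangle=\int_{\mathbb{R}} f(x)\langle F(\mathrm{d}x)h,h\rangle$ for all $h\in\mathcal{H}$. The spectral measure of a selfadjoint $T\in\boldsymbol{B}(\mathcal{H})$ is the unique spectral measure $G$ on $\mathfrak{B}(\mathbb{R})$ with $T=\int_{\mathbb{R}}x\,G(\mathrm{d}x)$. *)

theory Defs
  imports "HOL-Analysis.Analysis"
begin

text \<open>
  Complex Hilbert spaces. The inner product is linear in its first argument and conjugate-linear
  in its second one. The real structure and the norm are those of the library class
  \<open>real_normed_vector\<close>; completeness is \<open>complete_space\<close>. The zero space is allowed.
\<close>

class complex_hilbert = real_normed_vector + complete_space +
  fixes scaleC :: "complex \<Rightarrow> 'a \<Rightarrow> 'a"  (infixr "*\<^sub>C" 75)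
    and cinner :: "'a \<Rightarrow> 'a \<Rightarrow> complex"
  assumes scaleC_add_right: "c *\<^sub>C (x + y) = c *\<^sub>C x + c *\<^sub>C y"
    and scaleC_add_left: "(c + d) *\<^sub>C x = c *\<^sub>C x + d *\<^sub>C x"
    and scaleC_scaleC: "c *\<^sub>C (d *\<^sub>C x) = (c * d) *\<^sub>C x"
    and scaleC_of_real: "complex_of_real r *\<^sub>C x = r *\<^sub>R x"
    and cinner_add_left: "cinner (x + y) z = cinner x z + cinner y z"
    and cinner_scaleC_left: "cinner (c *\<^sub>C x) y = c * cinner x y"
    and cinner_commute: "cinner x y = cnj (cinner y x)"
    and cinner_self: "cinner x x = complex_of_real ((norm x)\<^sup>2)"

text \<open>Elements of the algebra of bounded operators are rendered as functions satisfying the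
  following predicate; the product is then composition, the identity is \<^term>\<open>id\<close> and the
  \<open>k\<close>-th power of \<open>T\<close> is \<^term>\<open>T ^^ k\<close>.\<close>

definition bounded_operator :: "('a::complex_hilbert \<Rightarrow> 'a) \<Rightarrow> bool" where
  "bounded_operator T \<longleftrightarrow> bounded_linear T \<and> (\<forall>c x. T (c *\<^sub>C x) = c *\<^sub>C T x)"

definition selfadjoint :: "('a::complex_hilbert \<Rightarrow> 'a) \<Rightarrow> bool" where
  "selfadjoint T \<longleftrightarrow> bounded_operator T \<and> (\<forall>x y. cinner (T x) y = cinner x (T y))"

definition orthogonal_projection :: "('a::complex_hilbert \<Rightarrow> 'a) \<Rightarrow> bool" where
  "orthogonal_projection P \<longleftrightarrow> selfadjoint P \<and> P \<circ> P = P"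

text \<open>Operator-valued maps on the Borel subsets of the real line are total functions on
  \<^typ>\<open>real set\<close>, whose values outside \<^term>\<open>sets (borel :: real measure)\<close> play no role.\<close>

definition semispectral_measure :: "(real set \<Rightarrow> 'a::complex_hilbert \<Rightarrow> 'a) \<Rightarrow> bool" where
  "semispectral_measure F \<longleftrightarrow>
     (\<forall>\<Delta>\<in>sets borel. bounded_operator (F \<Delta>)) \<and>
     (\<forall>h. (\<forall>\<Delta>\<in>sets borel. cinner (F \<Delta> h) h \<in> \<real> \<and> 0 \<le> Re (cinner (F \<Delta> h) h)) \<and>
          measure_space UNIV (sets borel) (\<lambda>\<Delta>. ennreal (Re (cinner (F \<Delta> h) h)))) \<and>
     F UNIV = id"

definition spectral_measure :: "(real set \<Rightarrow> 'a::complex_hilbert \<Rightarrow> 'a) \<Rightarrow> bool" where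
  "spectral_measure F \<longleftrightarrow>
     semispectral_measure F \<and> (\<forall>\<Delta>\<in>sets borel. orthogonal_projection (F \<Delta>))"

text \<open>The positive Borel measure \<open>\<langle>F(\<cdot>)h, h\<rangle>\<close>.\<close>

definition scalar_measure :: "(real set \<Rightarrow> 'a::complex_hilbert \<Rightarrow> 'a) \<Rightarrow> 'a \<Rightarrow> real measure" where
  "scalar_measure F h = measure_of UNIV (sets borel) (\<lambda>\<Delta>. ennreal (Re (cinner (F \<Delta> h) h)))"

definition closed_support :: "(real set \<Rightarrow> 'a::complex_hilbert \<Rightarrow> 'a) \<Rightarrow> real set" where
  "closed_support F = \<Inter>{C. closed C \<and> F (- C) = (\<lambda>_. 0)}"

definition semispectral_integrable ::
    "(real set \<Rightarrow> 'a::complex_hilbert \<Rightarrow> 'a) \<Rightarrow> (real \<Rightarrow> complex) \<Rightarrow> bool" where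
  "semispectral_integrable F f \<longleftrightarrow> (\<forall>h. integrable (scalar_measure F h) f)"

text \<open>Meaningful only if \<open>F\<close> is a semispectral measure and \<open>f\<close> is integrable in the above sense.\<close>

definition semispectral_integral ::
    "(real set \<Rightarrow> 'a::complex_hilbert \<Rightarrow> 'a) \<Rightarrow> (real \<Rightarrow> complex) \<Rightarrow> 'a \<Rightarrow> 'a" where
  "semispectral_integral F f =
     (THE A. bounded_operator A \<and>
             (\<forall>h. cinner (A h) h = (LINT x|scalar_measure F h. f x)))"

text \<open>By the spectral theorem, for a selfadjoint \<open>T\<close> there is, up to the irrelevant values
  outside the Borel sets, exactly one \<open>G\<close> with the following property.\<close>

definition is_spectral_measure_of ::
    "(real set \<Rightarrow> 'a::complex_hilbert \<Rightarrow> 'a) \<Rightarrow> ('a \<Rightarrow> 'a) \<Rightarrow> bool" where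
  "is_spectral_measure_of G T \<longleftrightarrow>
     spectral_measure G \<and> semispectral_integrable G complex_of_real \<and>
     T = semispectral_integral G complex_of_real"

end

theory Submission
  imports Defs
begin

text \<open>
  Write \<open>M\<^sub>k = \<integral> x\<^sup>k F(dx)\<close>. Conditions (i) and (ii) are both statements about the multiplicative
  domain of the map \<open>f \<mapsto> \<integral> f dF\<close> on bounded Borel functions, that is, about those \<open>f\<close> for which
  \<open>\<integral> f g dF = (\<integral> f dF)(\<integral> g dF)\<close> for all \<open>g\<close>. (As \<open>F\<close> has compact
  support, \<open>x\<close> counts as bounded.) By the Schwarz inequality
  \<open>\<parallel>(\<integral> f dF) h\<parallel>\<^sup>2 \<le> \<integral> |f|\<^sup>2 d\<langle>F h, h\<rangle>\<close> a real \<open>f\<close> lies in this domain as soon as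
  \<open>\<integral> f\<^sup>2 dF = (\<integral> f dF)\<^sup>2\<close> (lemma \<open>multiplicative_if_square\<close>); the domain is an algebra closed under
  bounded pointwise limits. If \<open>F\<close> is spectral, the domain contains the indicators, hence everything,
  and \<open>M\<^sub>k = M\<^sub>1\<^sup>k\<close>. If \<open>M\<^sub>1 = T\<close> and \<open>M\<^sub>2 = T\<^sup>2\<close>, it contains \<open>x\<close>, hence the indicators of Borel sets,
  so the values of \<open>F\<close> are projections.

  That two moments suffice rests on convexity. Since \<open>p\<close> is odd and \<open>q > p\<close> is even, \<open>x\<^sup>q\<close> is a
  strictly convex function of \<open>x\<^sup>p\<close>; its excess over the tangent at \<open>t\<close> is a combination \<open>\<psi>(x, t)\<close> of
  \<open>x\<^sup>q\<close>, \<open>x\<^sup>p\<close> and \<open>1\<close> with \<open>(x\<^sup>n - t\<^sup>n)\<^sup>2 \<le> K \<psi>(x, t)\<close> on bounded sets whenever \<open>2n \<ge> q\<close>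
  (lemma \<open>power_diff_square_le_moment_gap\<close>). Condition (iii) says that \<open>\<integral> \<psi>(x, t) F(dx) = \<psi>(T, t)\<close>,
  and \<open>\<psi>(T, t)\<close> contains the factor \<open>(T - t)\<^sup>2\<close>. With the Schwarz inequality,
  \<open>\<parallel>M\<^sub>n h - t\<^sup>n h\<parallel> \<le> C \<parallel>T h - t h\<parallel>\<close> for all \<open>h\<close> and all \<open>t\<close> in a bounded interval, and so
  \<open>\<parallel>(M\<^sub>n - T\<^sup>n) h\<parallel> \<le> C \<parallel>T h - t h\<parallel>\<close> with another constant. For an eigenvector \<open>h\<close> of \<open>T\<close> this
  shows \<open>M\<^sub>n h = T\<^sup>n h\<close>; lemma \<open>zero_if_bounded_by_all_translates\<close> shows that it forces \<open>M\<^sub>n = T\<^sup>n\<close> for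
  every selfadjoint \<open>T\<close>, whatever its spectrum. Thus \<open>M\<^sub>n = T\<^sup>n\<close> for all \<open>n \<ge> q/2\<close>. For odd \<open>n\<close> the
  function \<open>x\<^sup>n\<close> then lies in the multiplicative domain, and with it \<open>x\<close>, a continuous function of
  \<open>x\<^sup>n\<close>. Hence \<open>M\<^sub>k = M\<^sub>1\<^sup>k\<close> for all \<open>k\<close>, and two consecutive high powers identify \<open>M\<^sub>1\<close> with \<open>T\<close>
  (lemma \<open>selfadjoint_eq_if_two_powers_eq\<close>).
\<close>


section \<open>Complex inner products\<close>

lemma cinner_add_right: "cinner x (y + z) = cinner x y + cinner x z"
  for x :: "'a::complex_hilbert"
  by (metis cinner_add_left cinner_commute complex_cnj_add)

lemma cinner_scaleC_right: "cinner x (c *\<^sub>C y) = cnj c * cinner x y"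
  for x :: "'a::complex_hilbert"
  by (metis cinner_commute cinner_scaleC_left complex_cnj_mult)

lemma cinner_scaleR_left: "cinner (r *\<^sub>R x) y = of_real r * cinner x y"
  for x :: "'a::complex_hilbert"
  by (metis cinner_scaleC_left scaleC_of_real)

lemma cinner_scaleR_right: "cinner x (r *\<^sub>R y) = of_real r * cinner x y"
  for x :: "'a::complex_hilbert"
  by (metis cinner_scaleC_right complex_cnj_complex_of_real scaleC_of_real)

lemma cinner_zero_left [simp]: "cinner 0 y = 0" for y :: "'a::complex_hilbert"
  using cinner_add_left[of 0 0 y] by simp

lemma cinner_zero_right [simp]: "cinner y 0 = 0" for y :: "'a::complex_hilbert"
  using cinner_add_right[of y 0 0] by simp

lemma cinner_minus_left: "cinner (- x) y = - cinner x y" for y :: "'a::complex_hilbert"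
  using cinner_add_left[of x "- x" y] by (simp add: eq_neg_iff_add_eq_0 add.commute)

lemma cinner_minus_right: "cinner x (- y) = - cinner x y" for y :: "'a::complex_hilbert"
  using cinner_add_right[of x y "- y"] by (simp add: eq_neg_iff_add_eq_0 add.commute)

lemma cinner_diff_left: "cinner (x - z) y = cinner x y - cinner z y" for y :: "'a::complex_hilbert"
  using cinner_add_left[of x "- z" y] by (simp add: cinner_minus_left)

lemma cinner_diff_right: "cinner x (y - z) = cinner x y - cinner x z" for y :: "'a::complex_hilbert"
  using cinner_add_right[of x y "- z"] by (simp add: cinner_minus_right)

lemma cinner_sum_left: "cinner (\<Sum>i\<in>I. f i) y = (\<Sum>i\<in>I. cinner (f i) y)"
  for y :: "'a::complex_hilbert"
  by (induction I rule: infinite_finite_induct) (auto simp: cinner_add_left)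

lemma cinner_sum_right: "cinner y (\<Sum>i\<in>I. f i) = (\<Sum>i\<in>I. cinner y (f i))"
  for y :: "'a::complex_hilbert"
  by (induction I rule: infinite_finite_induct) (auto simp: cinner_add_right)

lemma Re_cinner_self: "Re (cinner x x) = (norm x)\<^sup>2" for x :: "'a::complex_hilbert"
  by (simp add: cinner_self)

lemma Re_cinner_commute: "Re (cinner x y) = Re (cinner y x)" for x :: "'a::complex_hilbert"
  by (subst cinner_commute) simp

lemmas cinner_algebra = cinner_add_left cinner_add_right cinner_diff_left cinner_diff_right
  cinner_minus_left cinner_minus_right cinner_scaleC_left cinner_scaleC_right
  cinner_scaleR_left cinner_scaleR_right

lemma norm_add_sqr: "(norm (x + y))\<^sup>2 = (norm x)\<^sup>2 + 2 * Re (cinner x y) + (norm y)\<^sup>2"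
  for x :: "'a::complex_hilbert"
  using Re_cinner_self[of "x + y"] Re_cinner_commute[of x y]
  by (simp add: cinner_algebra Re_cinner_self)

lemma norm_diff_sqr: "(norm (x - y))\<^sup>2 = (norm x)\<^sup>2 - 2 * Re (cinner x y) + (norm y)\<^sup>2"
  for x :: "'a::complex_hilbert"
  using norm_add_sqr[of x "- y"] by (simp add: cinner_minus_right)

lemma norm_scaleC: "norm (c *\<^sub>C x) = cmod c * norm x" for x :: "'a::complex_hilbert"
proof -
  have "complex_of_real ((norm (c *\<^sub>C x))\<^sup>2) = c * cnj c * complex_of_real ((norm x)\<^sup>2)"
    unfolding cinner_self[symmetric] by (simp add: cinner_algebra)
  also have "\<dots> = complex_of_real ((cmod c * norm x)\<^sup>2)"
    by (simp only: complex_norm_square[symmetric] of_real_power[symmetric] of_real_mult[symmetric]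
        power_mult_distrib)
  finally have "(norm (c *\<^sub>C x))\<^sup>2 = (cmod c * norm x)\<^sup>2"
    by (simp only: of_real_eq_iff)
  then show ?thesis
    by (simp add: power2_eq_iff_nonneg)
qed

text \<open>Cauchy--Schwarz: expand \<open>0 \<le> \<parallel>b x - a y\<parallel>\<^sup>2\<close> with \<open>a = \<parallel>x\<parallel>\<close> and \<open>b = \<parallel>y\<parallel>\<close>.\<close>

lemma Re_cinner_le_norm: "Re (cinner x y) \<le> norm x * norm y" for x :: "'a::complex_hilbert"
proof (cases "norm x * norm y = 0")
  case True
  then show ?thesis by auto
next
  case False
  let ?a = "norm x" and ?b = "norm y"
  have "0 \<le> (norm (?b *\<^sub>R x - ?a *\<^sub>R y))\<^sup>2" by simp
  also have "\<dots> = 2 * (?a * ?b) * (?a * ?b - Re (cinner x y))"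
    unfolding norm_diff_sqr by (simp add: cinner_algebra power2_eq_square algebra_simps)
  finally have "0 \<le> (?a * ?b) * (?a * ?b - Re (cinner x y))" by simp
  moreover have "?a * ?b > 0" using False by (simp add: less_le)
  ultimately show ?thesis by (simp add: zero_le_mult_iff)
qed

lemma abs_Re_cinner_le_norm: "\<bar>Re (cinner x y)\<bar> \<le> norm x * norm y" for x :: "'a::complex_hilbert"
  using Re_cinner_le_norm[of x y] Re_cinner_le_norm[of "- x" y] by (simp add: cinner_minus_left)

lemma cinner_tendsto_left:
  fixes f :: "nat \<Rightarrow> 'a::complex_hilbert"
  assumes "f \<longlonglongrightarrow> l"
  shows "(\<lambda>n. cinner (f n) y) \<longlonglongrightarrow> cinner l y"
proof -
  have re: "(\<lambda>n. Re (cinner (f n) z)) \<longlonglongrightarrow> Re (cinner l z)" for z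
  proof (rule LIM_zero_cancel, rule Lim_null_comparison)
    show "\<forall>\<^sub>F n in sequentially. norm (Re (cinner (f n) z) - Re (cinner l z)) \<le> norm (f n - l) * norm z"
      using abs_Re_cinner_le_norm[of "f _ - l" z] by (simp add: cinner_diff_left)
    show "(\<lambda>n. norm (f n - l) * norm z) \<longlonglongrightarrow> 0"
      using assms by (auto intro!: tendsto_eq_intros simp: LIM_zero_iff)
  qed
  have "Im (cinner x y) = Re (cinner x (\<i> *\<^sub>C y))" for x by (simp add: cinner_algebra)
  then show ?thesis using re[of y] re[of "\<i> *\<^sub>C y"] by (simp add: tendsto_complex_iff)
qed


section \<open>Bounded operators\<close>

lemma bounded_operatorD:
  assumes "bounded_operator A"
  shows "A (x + y) = A x + A y" "A (x - y) = A x - A y" "A (r *\<^sub>R x) = r *\<^sub>R A x"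
    "A (c *\<^sub>C x) = c *\<^sub>C A x" "A 0 = 0" "linear A" "bounded_linear A"
  using assms
  by (auto simp: bounded_operator_def linear_simps bounded_linear.linear linear_0)

lemma bounded_operator_bound:
  assumes "bounded_operator A" obtains K where "K > 0" "\<And>x. norm (A x) \<le> K * norm x"
  using bounded_linear.pos_bounded[of A] assms unfolding bounded_operator_def
  by (metis mult.commute)

lemma scaleC_minus_right: "c *\<^sub>C (- x) = - (c *\<^sub>C x)" for x :: "'a::complex_hilbert"
proof -
  have "norm (c *\<^sub>C (0::'a)) = 0" by (simp add: norm_scaleC)
  then have "c *\<^sub>C (x + - x) = 0" by simp
  then show ?thesis
    unfolding scaleC_add_right by (simp add: eq_neg_iff_add_eq_0 add.commute)
qed

lemma scaleC_diff_right: "c *\<^sub>C (x - y) = c *\<^sub>C x - c *\<^sub>C y" for x :: "'a::complex_hilbert"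
  using scaleC_add_right[of c x "- y"] by (simp add: scaleC_minus_right)

lemma scaleC_zero_right [simp]: "c *\<^sub>C (0::'a::complex_hilbert) = 0"
  using scaleC_diff_right[of c 0 "0::'a"] by simp

lemma scaleC_sum_right: "c *\<^sub>C (\<Sum>i\<in>I. f i) = (\<Sum>i\<in>I. c *\<^sub>C (f i :: 'a::complex_hilbert))"
  by (induction I rule: infinite_finite_induct) (auto simp: scaleC_add_right)

lemma scaleC_commute: "c *\<^sub>C (d *\<^sub>C x) = d *\<^sub>C (c *\<^sub>C x)" for x :: "'a::complex_hilbert"
  by (simp add: scaleC_scaleC mult.commute)

lemma scaleC_scaleR: "c *\<^sub>C (r *\<^sub>R x) = r *\<^sub>R (c *\<^sub>C x)" for x :: "'a::complex_hilbert"
  by (simp add: scaleC_of_real[symmetric] scaleC_commute)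

lemma bounded_linear_scaleC: "bounded_linear (\<lambda>x::'a::complex_hilbert. c *\<^sub>C x)"
  by (rule bounded_linear_intro[of _ "cmod c"])
    (auto simp: scaleC_add_right scaleC_scaleR norm_scaleC mult.commute)

lemma bounded_operator_id: "bounded_operator (id :: 'a::complex_hilbert \<Rightarrow> 'a)"
  by (simp add: bounded_operator_def id_def)

lemma bounded_operator_compose:
  "bounded_operator A \<Longrightarrow> bounded_operator B \<Longrightarrow> bounded_operator (A \<circ> B)"
  unfolding bounded_operator_def comp_def by (auto intro: bounded_linear_compose)

lemma bounded_operator_add:
  "bounded_operator A \<Longrightarrow> bounded_operator B \<Longrightarrow> bounded_operator (\<lambda>x. A x + B x)"
  unfolding bounded_operator_def by (auto intro: bounded_linear_add simp: scaleC_add_right)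

lemma bounded_operator_diff:
  "bounded_operator A \<Longrightarrow> bounded_operator B \<Longrightarrow> bounded_operator (\<lambda>x. A x - B x)"
  unfolding bounded_operator_def by (auto intro: bounded_linear_sub simp: scaleC_diff_right)

lemma bounded_operator_scaleC:
  "bounded_operator A \<Longrightarrow> bounded_operator (\<lambda>x. c *\<^sub>C A x)"
  unfolding bounded_operator_def
  by (auto intro: bounded_linear_compose[OF bounded_linear_scaleC] simp: scaleC_commute)

lemma bounded_operator_sum:
  "(\<And>i. i \<in> I \<Longrightarrow> bounded_operator (A i)) \<Longrightarrow> bounded_operator (\<lambda>x. \<Sum>i\<in>I. A i x)"
  unfolding bounded_operator_def by (auto intro: bounded_linear_sum simp: scaleC_sum_right)

lemma bounded_operator_funpow: "bounded_operator A \<Longrightarrow> bounded_operator (A ^^ k)"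
  by (induction k) (auto simp: bounded_operator_id bounded_operator_compose)

text \<open>Polarization: a sesquilinear form on a complex space is determined by its diagonal. Comparing
  the values at \<open>x + y\<close> and at \<open>x + \<i>y\<close> isolates \<open>s x y\<close>.\<close>

lemma sesquilinear_zero_if_diagonal_zero:
  fixes s :: "'a::complex_hilbert \<Rightarrow> 'a \<Rightarrow> complex"
  assumes diag: "\<And>h. s h h = 0"
    and add1: "\<And>x y z. s (x + y) z = s x z + s y z"
    and add2: "\<And>x y z. s x (y + z) = s x y + s x z"
    and scale1: "\<And>c x y. s (c *\<^sub>C x) y = c * s x y"
    and scale2: "\<And>c x y. s x (c *\<^sub>C y) = cnj c * s x y"
  shows "s x y = 0"
proof -
  have anti: "s x y + s y x = 0" for x y
    using diag[of "x + y"] diag[of x] diag[of y] by (simp add: add1 add2 add.commute)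
  have "\<i> * (s y x - s x y) = 0"
    using anti[of x "\<i> *\<^sub>C y"] by (simp add: scale1 scale2 algebra_simps)
  then have "s y x = s x y" by simp
  with anti[of x y] show ?thesis by simp
qed

lemma bounded_operator_eqI:
  fixes A B :: "'a::complex_hilbert \<Rightarrow> 'a"
  assumes "bounded_operator A" "bounded_operator B"
    and "\<And>h. cinner (A h) h = cinner (B h) h"
  shows "A = B"
proof
  fix x
  have "cinner (A x - B x) y = 0" for y
    by (rule sesquilinear_zero_if_diagonal_zero[where s = "\<lambda>x y. cinner (A x - B x) y"])
      (use assms in \<open>auto simp: cinner_algebra bounded_operatorD algebra_simps\<close>)
  from this[of "A x - B x"] show "A x = B x" by (simp add: cinner_self)
qed

lemma selfadjointI_real:
  fixes A :: "'a::complex_hilbert \<Rightarrow> 'a"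
  assumes "bounded_operator A" and "\<And>h. cinner (A h) h \<in> \<real>"
  shows "selfadjoint A"
proof -
  have "cinner (A x) y - cinner x (A y) = 0" for x y
  proof (rule sesquilinear_zero_if_diagonal_zero[where s = "\<lambda>x y. cinner (A x) y - cinner x (A y)"])
    show "cinner (A h) h - cinner h (A h) = 0" for h
      using assms(2)[of h] cinner_commute[of h "A h"] by (simp add: Reals_cnj_iff)
  qed (use assms(1) in \<open>auto simp: cinner_algebra bounded_operatorD algebra_simps\<close>)
  then show ?thesis using assms(1) by (simp add: selfadjoint_def)
qed

lemma selfadjoint_cinner: "selfadjoint A \<Longrightarrow> cinner (A x) y = cinner x (A y)"
  by (simp add: selfadjoint_def)

lemma selfadjoint_bounded_operator: "selfadjoint A \<Longrightarrow> bounded_operator A"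
  by (simp add: selfadjoint_def)

lemma selfadjoint_cinner_real:
  assumes "selfadjoint A" shows "cinner (A h) h = complex_of_real (Re (cinner (A h) h))"
  using assms cinner_commute[of "A h" h]
  by (metis selfadjoint_cinner Reals_cnj_iff of_real_Re)

text \<open>By selfadjointness \<open>\<parallel>A\<^sup>k\<^sup>+\<^sup>1 y\<parallel>\<^sup>2 = Re \<langle>A\<^sup>k y, A\<^sup>k\<^sup>+\<^sup>2 y\<rangle>\<close>, so the exponent can be lowered down to one.\<close>

lemma selfadjoint_funpow_kernel:
  assumes A: "selfadjoint A" and "(A ^^ Suc k) y = 0"
  shows "A y = 0"
  using assms(2)
proof (induction k)
  case (Suc k)
  have "cinner ((A ^^ Suc k) y) ((A ^^ Suc k) y) = cinner ((A ^^ k) y) ((A ^^ Suc (Suc k)) y)"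
    using A by (simp add: selfadjoint_cinner)
  then have "(A ^^ Suc k) y = 0" using Suc.prems by (simp add: cinner_self)
  then show ?case by (rule Suc.IH)
qed simp

text \<open>Put \<open>D = A - B\<close>. The hypotheses give \<open>A\<^sup>mD = 0 = B\<^sup>mD\<close>, so \<open>D\<close> maps into the kernels of both
  \<open>A\<close> and \<open>B\<close>; hence \<open>D\<^sup>2 = 0\<close>, and a selfadjoint operator with square zero vanishes.\<close>

lemma selfadjoint_eq_if_two_powers_eq:
  assumes A: "selfadjoint A" and B: "selfadjoint B"
    and m: "A ^^ m = B ^^ m" and Sm: "A ^^ Suc m = B ^^ Suc m" and "m > 0"
  shows "A = B"
proof
  fix x
  let ?D = "\<lambda>x. A x - B x"
  obtain k where k: "m = Suc k" using \<open>m > 0\<close> by (cases m) auto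
  have pA: "bounded_operator (A ^^ m)"
    using A by (intro bounded_operator_funpow selfadjoint_bounded_operator)
  have "(A ^^ m) (A x) = (B ^^ m) (B x)" using Sm by (metis funpow_swap1 funpow.simps(2) comp_apply)
  then have 1: "(A ^^ m) (?D x) = 0" using m by (simp add: bounded_operatorD(2)[OF pA[unfolded m]])
  then have 2: "(B ^^ m) (?D x) = 0" using m by simp
  have "A (?D x) = 0" "B (?D x) = 0"
    using selfadjoint_funpow_kernel[OF A] selfadjoint_funpow_kernel[OF B] 1 2 k by metis+
  then have "cinner (?D x) (?D x) = 0"
    using A B by (simp add: cinner_diff_left selfadjoint_cinner)
  then show "A x = B x" by (simp add: cinner_self)
qed


section \<open>Localisation: a bound by all translates forces zero\<close>

lemma has_integral_cos_int_multiple: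
  fixes m :: int
  assumes "m \<noteq> 0"
  shows "((\<lambda>\<theta>. cos (of_int m * \<theta>)) has_integral 0) {0..pi}"
proof -
  have "((\<lambda>\<theta>. cos (of_int m * \<theta>)) has_integral
      sin (of_int m * pi) / of_int m - sin (of_int m * 0) / of_int m) {0..pi}"
    using assms
    by (intro fundamental_theorem_of_calculus)
      (auto intro!: derivative_eq_intros simp: has_real_derivative_iff_has_vector_derivative[symmetric])
  then show ?thesis by (simp add: sin_int_times_real mult.commute)
qed

lemma has_integral_sin_sin:
  fixes k l :: nat
  assumes "k > 0" "l > 0"
  shows "((\<lambda>\<theta>. sin (real k * \<theta>) * sin (real l * \<theta>)) has_integral (if k = l then pi / 2 else 0)) {0..pi}"
proof -
  have eq: "sin (real k * \<theta>) * sin (real l * \<theta>) =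
      (cos (of_int (int k - int l) * \<theta>) - cos (of_int (int k + int l) * \<theta>)) / 2" for \<theta>
    by (simp add: sin_times_sin algebra_simps)
  have 1: "((\<lambda>\<theta>. cos (of_int (int k - int l) * \<theta>)) has_integral (if k = l then pi else 0)) {0..pi}"
    using has_integral_cos_int_multiple[of "int k - int l"] has_integral_const_real[of "1::real" 0 pi]
    by auto
  have 2: "((\<lambda>\<theta>. cos (of_int (int k + int l) * \<theta>)) has_integral 0) {0..pi}"
    using has_integral_cos_int_multiple[of "int k + int l"] assms by simp
  show ?thesis unfolding eq
    using has_integral_divide[OF has_integral_diff[OF 1 2], of 2] by (auto split: if_splits)
qed

lemma Parseval_sine_sum:
  fixes v :: "nat \<Rightarrow> 'a::complex_hilbert"
  shows "((\<lambda>\<theta>. (norm (\<Sum>k=1..N. sin (real k * \<theta>) *\<^sub>R v k))\<^sup>2) has_integral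
            pi / 2 * (\<Sum>k=1..N. (norm (v k))\<^sup>2)) {0..pi}"
proof -
  have eq: "(norm (\<Sum>k=1..N. sin (real k * \<theta>) *\<^sub>R v k))\<^sup>2 =
      (\<Sum>k=1..N. \<Sum>l=1..N. sin (real k * \<theta>) * sin (real l * \<theta>) * Re (cinner (v l) (v k)))" for \<theta>
    unfolding Re_cinner_self[symmetric]
    by (simp add: cinner_sum_left cinner_sum_right cinner_algebra sum_distrib_left mult.assoc)
  have "((\<lambda>\<theta>. \<Sum>k=1..N. \<Sum>l=1..N. sin (real k * \<theta>) * sin (real l * \<theta>) * Re (cinner (v l) (v k)))
      has_integral (\<Sum>k=1..N. \<Sum>l=1..N. (if k = l then pi / 2 else 0) * Re (cinner (v l) (v k)))) {0..pi}"
    by (intro has_integral_sum has_integral_mult_left has_integral_sin_sin) auto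
  also have "(\<Sum>k=1..N. \<Sum>l=1..N. (if k = l then pi / 2 else 0) * Re (cinner (v l) (v k))) =
      pi / 2 * (\<Sum>k=1..N. (norm (v k))\<^sup>2)"
    by (simp add: if_distrib[of "\<lambda>x. x * _"] sum_distrib_left Re_cinner_self cong: if_cong)
  finally show ?thesis unfolding eq .
qed

text \<open>\<open>chebyshev_orbit S h k = U\<^bsub>k-1\<^esub>(S/2) h\<close> with the Chebyshev polynomials of the second kind.\<close>

fun chebyshev_orbit :: "('a::real_vector \<Rightarrow> 'a) \<Rightarrow> 'a \<Rightarrow> nat \<Rightarrow> 'a" where
  "chebyshev_orbit S h 0 = 0"
| "chebyshev_orbit S h (Suc 0) = h"
| "chebyshev_orbit S h (Suc (Suc k)) = S (chebyshev_orbit S h (Suc k)) - chebyshev_orbit S h k"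

text \<open>The recursion is a discrete wave equation; its energy
  \<open>\<parallel>u\<^sub>k\<parallel>\<^sup>2 + \<parallel>u\<^sub>k\<^sub>+\<^sub>1\<parallel>\<^sup>2 - Re \<langle>S u\<^sub>k, u\<^sub>k\<^sub>+\<^sub>1\<rangle>\<close> is conserved, and for a contraction \<open>S\<close> it dominates half of
  \<open>\<parallel>u\<^sub>k\<parallel>\<^sup>2\<close>.\<close>

lemma norm_chebyshev_orbit:
  fixes S :: "'a::complex_hilbert \<Rightarrow> 'a"
  assumes sym: "\<And>x y. cinner (S x) y = cinner x (S y)"
    and contr: "\<And>x. norm (S x) \<le> norm x"
  shows "(norm (chebyshev_orbit S h k))\<^sup>2 \<le> 2 * (norm h)\<^sup>2"
proof -
  let ?u = "chebyshev_orbit S h"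
  have zero: "S 0 = 0" using contr[of 0] by simp
  \<comment> \<open>initially \<open>u\<^sub>0 = 0\<close> and \<open>u\<^sub>1 = h\<close>, so the energy is \<open>\<parallel>h\<parallel>\<^sup>2\<close>\<close>
  have energy: "(norm (?u k))\<^sup>2 + (norm (?u (Suc k)))\<^sup>2 - Re (cinner (S (?u k)) (?u (Suc k))) = (norm h)\<^sup>2"
  proof (induction k)
    case 0
    then show ?case by (simp add: zero)
  next
    case (Suc k)
    let ?a = "?u k" and ?b = "?u (Suc k)"
    have "Re (cinner (S ?a) ?b) = Re (cinner (S ?b) ?a)"
      by (metis sym Re_cinner_commute)
    then show ?case using Suc
      by (simp add: norm_diff_sqr cinner_algebra Re_cinner_self)
  qed
  have "Re (cinner (S (?u k)) (?u (Suc k))) \<le> norm (?u k) * norm (?u (Suc k))"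
    using Re_cinner_le_norm contr[of "?u k"] by (meson mult_right_mono norm_ge_zero order_trans)
  moreover have "0 \<le> (norm (?u k))\<^sup>2 - 2 * (norm (?u k) * norm (?u (Suc k))) + (norm (?u (Suc k)))\<^sup>2"
    using zero_le_power2[of "norm (?u k) - norm (?u (Suc k))"] by (simp add: power2_diff)
  ultimately show ?thesis using energy zero_le_power2[of "norm (?u (Suc k))"] by linarith
qed

text \<open>Summation by parts: on a sine sum with coefficients \<open>c\<^sub>k u\<^sub>k\<close> the operator \<open>S - 2 cos \<theta>\<close> only sees
  the increments of \<open>c\<close>, because it annihilates \<open>\<Sum> sin (k\<theta>) u\<^sub>k\<close> formally.\<close>

lemma chebyshev_orbit_sine_sum:
  fixes S :: "'a::real_vector \<Rightarrow> 'a" and h :: 'a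
  assumes "linear S" and "c N = 0" "c (Suc N) = 0"
  defines "u \<equiv> chebyshev_orbit S h"
  shows "S (\<Sum>k=1..N. sin (real k * \<theta>) *\<^sub>R c k *\<^sub>R u k)
           - (2 * cos \<theta>) *\<^sub>R (\<Sum>k=1..N. sin (real k * \<theta>) *\<^sub>R c k *\<^sub>R u k)
       = (\<Sum>k=1..N. sin (real k * \<theta>) *\<^sub>R
            ((c k - c (k - 1)) *\<^sub>R u (k - 1) + (c k - c (Suc k)) *\<^sub>R u (Suc k)))"
proof -
  define s where "s k = sin (real k * \<theta>)" for k
  define a where "a k = c k *\<^sub>R u k" for k
  define d where "d k = s k *\<^sub>R a (Suc k) - s (Suc k) *\<^sub>R a k" for k
  have trig: "2 * cos \<theta> * s (Suc j) = s j + s (Suc (Suc j))" for j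
  proof -
    have "s j = sin (real (Suc j) * \<theta> - \<theta>)" "s (Suc (Suc j)) = sin (real (Suc j) * \<theta> + \<theta>)"
      by (simp_all add: s_def algebra_simps)
    then show ?thesis by (simp add: s_def sin_add sin_diff)
  qed
  have step: "s (Suc j) *\<^sub>R c (Suc j) *\<^sub>R S (u (Suc j)) - (2 * cos \<theta>) *\<^sub>R s (Suc j) *\<^sub>R a (Suc j)
      - s (Suc j) *\<^sub>R ((c (Suc j) - c j) *\<^sub>R u j + (c (Suc j) - c (Suc (Suc j))) *\<^sub>R u (Suc (Suc j)))
      = d (Suc j) - d j" for j
  proof -
    have "S (u (Suc j)) = u (Suc (Suc j)) + u j" by (simp add: u_def)
    moreover have "(2 * cos \<theta>) *\<^sub>R s (Suc j) *\<^sub>R a (Suc j) = s j *\<^sub>R a (Suc j) + s (Suc (Suc j)) *\<^sub>R a (Suc j)"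
      by (simp add: trig scaleR_add_left)
    ultimately show ?thesis
      by (simp add: a_def d_def algebra_simps)
  qed
  have "(\<Sum>k=1..N. s k *\<^sub>R c k *\<^sub>R S (u k) - (2 * cos \<theta>) *\<^sub>R s k *\<^sub>R a k
      - s k *\<^sub>R ((c k - c (k - 1)) *\<^sub>R u (k - 1) + (c k - c (Suc k)) *\<^sub>R u (Suc k)))
      = (\<Sum>j<N. d (Suc j) - d j)"
    using step by (simp add: sum.atLeast1_atMost_eq)
  also have "\<dots> = d N - d 0" by (rule sum_lessThan_telescope)
  also have "\<dots> = 0" using assms by (simp add: d_def a_def s_def)
  finally show ?thesis
    by (simp add: linear_sum[OF assms(1)] linear_scale[OF assms(1)] sum_subtractf scaleR_sum_right
        s_def a_def)
qed

text \<open>On eigenvectors of \<open>T\<close> the hypothesis gives \<open>W h = 0\<close> at once. In general the sums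
  \<open>f \<theta> = \<Sum> sin (k\<theta>) c\<^sub>k u\<^sub>k\<close> over the Chebyshev orbit of \<open>h\<close>, with coefficients \<open>c\<^sub>k\<close> decreasing slowly to
  zero, serve as approximate eigenvectors for \<open>t = 2R cos \<theta>\<close>. No single one need be informative, but
  the mean square over \<open>\<theta>\<close> of the hypothesis for \<open>f \<theta>\<close> is: by Parseval its left-hand side is at
  least a multiple of \<open>\<parallel>W h\<parallel>\<^sup>2\<close>, the contribution of \<open>u\<^sub>1 = h\<close>, while its right-hand side is a sum of \<open>N\<close>
  terms of size \<open>1/N\<^sup>2\<close>.\<close>

lemma zero_if_bounded_by_all_translates:
  fixes T W :: "'a::complex_hilbert \<Rightarrow> 'a"
  assumes sym: "\<And>x y. cinner (T x) y = cinner x (T y)" and "linear T"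
    and TR: "\<And>x. norm (T x) \<le> R * norm x" and "R > 0"
    and "linear W" and "C \<ge> 0"
    and bound: "\<And>x t. \<bar>t\<bar> \<le> 2 * R \<Longrightarrow> norm (W x) \<le> C * norm (T x - t *\<^sub>R x)"
  shows "W h = 0"
proof -
  define S where "S x = (1 / R) *\<^sub>R T x" for x
  define u where "u = chebyshev_orbit S h"
  have linS: "linear S"
    unfolding S_def using \<open>linear T\<close> by (rule linear_compose_scale_right)
  have S_contr: "norm (S x) \<le> norm x" for x
    using TR[of x] \<open>R > 0\<close> by (simp add: S_def field_simps)
  have u_bound: "(norm (u k))\<^sup>2 \<le> 2 * (norm h)\<^sup>2" for k
    unfolding u_def by (rule norm_chebyshev_orbit[OF _ S_contr]) (simp add: S_def cinner_algebra sym)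
  have main: "(norm (W h))\<^sup>2 \<le> 32 * C\<^sup>2 * R\<^sup>2 * (norm h)\<^sup>2 / real N" if "N \<ge> 2" for N
  proof -
    \<comment> \<open>consecutive values differ by at most \<open>1/N\<close>, and \<open>c 1 \<ge> 1/2\<close> is bounded below\<close>
    define c where "c k = (if k \<le> N then 1 - real k / real N else 0)" for k
    define w where "w k = (c k - c (k - 1)) *\<^sub>R u (k - 1) + (c k - c (Suc k)) *\<^sub>R u (Suc k)" for k
    define f where "f \<theta> = (\<Sum>k=1..N. sin (real k * \<theta>) *\<^sub>R c k *\<^sub>R u k)" for \<theta>
    have Sf: "S (f \<theta>) - (2 * cos \<theta>) *\<^sub>R f \<theta> = (\<Sum>k=1..N. sin (real k * \<theta>) *\<^sub>R w k)" for \<theta>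
      unfolding f_def w_def u_def
      by (rule chebyshev_orbit_sine_sum[OF linS]) (use that in \<open>auto simp: c_def\<close>)
    have Wf: "W (f \<theta>) = (\<Sum>k=1..N. sin (real k * \<theta>) *\<^sub>R W (c k *\<^sub>R u k))" for \<theta>
      unfolding f_def using \<open>linear W\<close> by (simp add: linear_sum linear_scale)
    have le: "(norm (W (f \<theta>)))\<^sup>2 \<le> (C * R)\<^sup>2 * (norm (S (f \<theta>) - (2 * cos \<theta>) *\<^sub>R f \<theta>))\<^sup>2" for \<theta>
    proof -
      have "\<bar>2 * R * cos \<theta>\<bar> \<le> 2 * R" using \<open>R > 0\<close> by (simp add: abs_mult)
      from bound[OF this, of "f \<theta>"]
      have "norm (W (f \<theta>)) \<le> C * norm (T (f \<theta>) - (2 * R * cos \<theta>) *\<^sub>R f \<theta>)" .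
      also have "T (f \<theta>) - (2 * R * cos \<theta>) *\<^sub>R f \<theta> = R *\<^sub>R (S (f \<theta>) - (2 * cos \<theta>) *\<^sub>R f \<theta>)"
        using \<open>R > 0\<close> by (simp add: S_def scaleR_diff_right mult_ac)
      finally have "norm (W (f \<theta>)) \<le> C * R * norm (S (f \<theta>) - (2 * cos \<theta>) *\<^sub>R f \<theta>)"
        using \<open>R > 0\<close> by (simp add: mult.assoc)
      from power_mono[OF this, of 2] show ?thesis by (simp add: power_mult_distrib)
    qed
    have "pi / 2 * (\<Sum>k=1..N. (norm (W (c k *\<^sub>R u k)))\<^sup>2)
        \<le> (C * R)\<^sup>2 * (pi / 2 * (\<Sum>k=1..N. (norm (w k))\<^sup>2))"
      using Parseval_sine_sum[of "\<lambda>k. W (c k *\<^sub>R u k)" N, folded Wf]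
        has_integral_mult_right[OF Parseval_sine_sum[of w N, folded Sf], of "(C * R)\<^sup>2"] le
      by (rule has_integral_le)
    then have sums: "(\<Sum>k=1..N. (norm (W (c k *\<^sub>R u k)))\<^sup>2) \<le> (C * R)\<^sup>2 * (\<Sum>k=1..N. (norm (w k))\<^sup>2)"
      by (simp add: mult.left_commute[of _ pi])
    have w_le: "(norm (w k))\<^sup>2 \<le> 8 / (real N)\<^sup>2 * (norm h)\<^sup>2" if "k \<in> {1..N}" for k
    proof -
      have c1: "\<bar>c k - c (k - 1)\<bar> = 1 / real N" "\<bar>c k - c (Suc k)\<bar> \<le> 1 / real N"
        using that \<open>N \<ge> 2\<close> by (cases "k = N"; auto simp: c_def field_simps of_nat_diff)+
      have "norm (w k) \<le> \<bar>c k - c (k - 1)\<bar> * norm (u (k - 1)) + \<bar>c k - c (Suc k)\<bar> * norm (u (Suc k))"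
        unfolding w_def using norm_triangle_ineq by (metis norm_scaleR)
      also have "\<dots> \<le> 1 / real N * (norm (u (k - 1)) + norm (u (Suc k)))"
        using c1 mult_right_mono[OF c1(2), of "norm (u (Suc k))"] by (simp add: distrib_left)
      finally have "(norm (w k))\<^sup>2 \<le> (1 / real N * (norm (u (k - 1)) + norm (u (Suc k))))\<^sup>2"
        by (rule power_mono) simp
      also have "\<dots> = (1 / real N)\<^sup>2 * (norm (u (k - 1)) + norm (u (Suc k)))\<^sup>2"
        by (simp only: power_mult_distrib)
      also have "\<dots> \<le> (1 / real N)\<^sup>2 * (8 * (norm h)\<^sup>2)"
      proof (rule mult_left_mono)
        have "(norm (u (k - 1)) + norm (u (Suc k)))\<^sup>2 \<le> 2 * (norm (u (k - 1)))\<^sup>2 + 2 * (norm (u (Suc k)))\<^sup>2"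
          using zero_le_power2[of "norm (u (k - 1)) - norm (u (Suc k))"]
          by (simp add: power2_eq_square algebra_simps)
        then show "(norm (u (k - 1)) + norm (u (Suc k)))\<^sup>2 \<le> 8 * (norm h)\<^sup>2"
          using u_bound[of "k - 1"] u_bound[of "Suc k"] by linarith
      qed simp
      finally show ?thesis by (simp add: power_divide)
    qed
    have "(\<Sum>k=1..N. (norm (w k))\<^sup>2) \<le> (\<Sum>k=1..N. 8 / (real N)\<^sup>2 * (norm h)\<^sup>2)"
      by (rule sum_mono) (rule w_le)
    also have "\<dots> = 8 * (norm h)\<^sup>2 / real N"
      using that by (simp add: power2_eq_square field_simps)
    finally have "(C * R)\<^sup>2 * (\<Sum>k=1..N. (norm (w k))\<^sup>2) \<le> (C * R)\<^sup>2 * (8 * (norm h)\<^sup>2 / real N)"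
      by (rule mult_left_mono) simp
    moreover have "(norm (W (c 1 *\<^sub>R u 1)))\<^sup>2 \<le> (\<Sum>k=1..N. (norm (W (c k *\<^sub>R u k)))\<^sup>2)"
      using that by (intro member_le_sum) auto
    moreover have "(norm (W (c 1 *\<^sub>R u 1)))\<^sup>2 \<ge> 1 / 4 * (norm (W h))\<^sup>2"
    proof -
      have "c 1 \<ge> 1 / 2" using that by (simp add: c_def field_simps)
      then have "(1 / 2)\<^sup>2 \<le> (c 1)\<^sup>2" by (intro power_mono) auto
      then have "1 / 4 * (norm (W h))\<^sup>2 \<le> (c 1)\<^sup>2 * (norm (W h))\<^sup>2"
        by (intro mult_right_mono) (auto simp: power_divide)
      then show ?thesis
        using \<open>linear W\<close> by (simp add: linear_scale u_def power_mult_distrib)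
    qed
    ultimately show ?thesis using sums by (simp add: power_mult_distrib)
  qed
  have "(\<lambda>N. 32 * C\<^sup>2 * R\<^sup>2 * (norm h)\<^sup>2 / real N) \<longlonglongrightarrow> 0"
    by (rule lim_const_over_n)
  then have "(norm (W h))\<^sup>2 \<le> 0"
    by (rule LIMSEQ_le_const) (use main in blast)
  then show ?thesis by simp
qed


section \<open>Quantitative convexity of the two monomials\<close>

text \<open>The excess of \<open>x\<^sup>q\<close> over its tangent at \<open>t\<close>, both regarded as functions of \<open>x\<^sup>p\<close>
  (and multiplied by \<open>p\<close>).\<close>

definition moment_gap :: "nat \<Rightarrow> nat \<Rightarrow> real \<Rightarrow> real \<Rightarrow> real" where
  "moment_gap p q x t = real p * x ^ q - real q * x ^ p * t ^ (q - p) + real (q - p) * t ^ q"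

lemma moment_gap_swap:
  assumes "p < q" shows "moment_gap p q x t = moment_gap (q - p) q t x"
  using assms by (simp add: moment_gap_def algebra_simps)

text \<open>The case \<open>q = p + 1\<close>, \<open>t = 1\<close>: here the gap equals \<open>(s - 1)\<^sup>2 \<Sum>\<^sub>l\<^sub><\<^sub>p (l + 1) s\<^sup>l\<close>, and the induction
  adds these terms one at a time, starting from \<open>(s - 1)\<^sup>2\<close>.\<close>

lemma moment_gap_adjacent_ge:
  fixes s :: real
  assumes "s \<ge> 0"
  shows "real (Suc p) * s ^ Suc (Suc p) - real (Suc (Suc p)) * s ^ Suc p + 1 \<ge> (s - 1)\<^sup>2"
proof (induction p)
  case 0
  then show ?case by (simp add: power2_eq_square algebra_simps)
next
  case (Suc p)
  have "real (Suc (Suc p)) * s ^ Suc (Suc (Suc p)) - real (Suc (Suc (Suc p))) * s ^ Suc (Suc p) + 1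
      = real (Suc p) * s ^ Suc (Suc p) - real (Suc (Suc p)) * s ^ Suc p + 1
        + real (Suc (Suc p)) * s ^ Suc p * (s - 1)\<^sup>2"
    by (simp add: power2_eq_square algebra_simps)
  moreover have "real (Suc (Suc p)) * s ^ Suc p * (s - 1)\<^sup>2 \<ge> 0"
    using assms by simp
  ultimately show ?case using Suc.IH by linarith
qed

text \<open>Induction on \<open>q\<close>: passing from \<open>q\<close> to \<open>q + 1\<close> multiplies the gap by \<open>s\<close> and adds the gap of the
  pair \<open>(p, p + 1)\<close> and a nonnegative term.\<close>

lemma moment_gap_one_ge:
  fixes s :: real
  assumes "s \<ge> 0" and "0 < p" "p < q"
  shows "moment_gap p q s 1 \<ge> (s - 1)\<^sup>2"
  using assms(3)
proof (induction q)
  case (Suc q)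
  obtain p' where p': "p = Suc p'" using \<open>0 < p\<close> by (cases p) auto
  have base: "moment_gap p (Suc p) s 1 \<ge> (s - 1)\<^sup>2"
    using moment_gap_adjacent_ge[OF assms(1), of p'] by (simp add: moment_gap_def p' algebra_simps)
  show ?case
  proof (cases "p = q")
    case True
    then show ?thesis using base by simp
  next
    case False
    with Suc.prems have "p < q" by simp
    have "moment_gap p (Suc q) s 1
        = s * moment_gap p q s 1 + moment_gap p (Suc p) s 1 + real (q - p) * ((s - 1) * (s ^ p - 1))"
      using \<open>p < q\<close> by (simp add: moment_gap_def algebra_simps of_nat_diff Suc_diff_le)
    moreover have "s * moment_gap p q s 1 \<ge> 0"
      using Suc.IH[OF \<open>p < q\<close>] assms(1) zero_le_power2[of "s - 1"]
      by (intro mult_nonneg_nonneg) linarith+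
    moreover have "(s - 1) * (s ^ p - 1) \<ge> 0"
      using assms(1) by (cases "s \<ge> 1") (auto simp: zero_le_mult_iff one_le_power power_le_one)
    ultimately show ?thesis using base by (smt (verit) mult_nonneg_nonneg of_nat_0_le_iff)
  qed
qed simp

text \<open>For \<open>t \<noteq> 0\<close> this is the previous lemma by homogeneity of degree \<open>q\<close>.\<close>

lemma moment_gap_nonneg_args_ge:
  fixes x t :: real
  assumes "x \<ge> 0" "t \<ge> 0" and "0 < p" "p < q"
  shows "moment_gap p q x t \<ge> (x - t)\<^sup>2 * t ^ (q - 2)"
proof (cases "t = 0")
  case True
  show ?thesis
  proof (cases "q = 2")
    case True
    then have "p = 1" using assms by simp
    then show ?thesis using \<open>t = 0\<close> True by (simp add: moment_gap_def)
  next
    case False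
    then show ?thesis using \<open>t = 0\<close> assms by (simp add: moment_gap_def power_0_left)
  qed
next
  case False
  have "q = p + (q - p)" "q = 2 + (q - 2)" using assms by simp_all
  then have q: "t ^ q = t ^ p * t ^ (q - p)" "t ^ q = t\<^sup>2 * t ^ (q - 2)"
    by (metis power_add)+
  have "moment_gap p q x t = t ^ q * moment_gap p q (x / t) 1"
  proof -
    have "t ^ q * (x / t) ^ q = x ^ q" using False by (simp add: power_divide)
    moreover have "t ^ q * (x / t) ^ p = x ^ p * t ^ (q - p)"
      unfolding q(1) using False by (simp add: power_divide)
    ultimately show ?thesis by (simp add: moment_gap_def algebra_simps)
  qed
  moreover have "\<dots> \<ge> t ^ q * (x / t - 1)\<^sup>2"
    using assms by (intro mult_left_mono moment_gap_one_ge) auto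
  moreover have "t ^ q * (x / t - 1)\<^sup>2 = (x - t)\<^sup>2 * t ^ (q - 2)"
    unfolding q(2) using False by (simp add: power2_eq_square field_simps)
  ultimately show ?thesis by simp
qed

text \<open>For arguments of equal sign this is the previous lemma and its mirror image. For arguments of
  opposite sign the mixed term helps, because \<open>p\<close> and \<open>q - p\<close> are odd.\<close>

lemma moment_gap_ge:
  fixes x t :: real
  assumes "0 < p" "p < q" "odd p" "even q"
  shows "4 * moment_gap p q x t \<ge> (x - t)\<^sup>2 * (max \<bar>x\<bar> \<bar>t\<bar>) ^ (q - 2)"
proof -
  have "odd (q - p)" using assms by simp
  have same: "4 * moment_gap p q x t \<ge> (x - t)\<^sup>2 * (max \<bar>x\<bar> \<bar>t\<bar>) ^ (q - 2)"
    if "x \<ge> 0" "t \<ge> 0" for x t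
  proof -
    have "moment_gap p q x t \<ge> (x - t)\<^sup>2 * t ^ (q - 2)"
      using moment_gap_nonneg_args_ge that assms by blast
    moreover have "moment_gap p q x t \<ge> (x - t)\<^sup>2 * x ^ (q - 2)"
      using moment_gap_nonneg_args_ge[of t x "q - p" q] that assms
      by (simp add: moment_gap_swap[of p q x t] power2_commute)
    moreover from calculation have "moment_gap p q x t \<ge> 0"
      using that by (meson order_trans mult_nonneg_nonneg zero_le_power zero_le_power2)
    ultimately have "(x - t)\<^sup>2 * t ^ (q - 2) \<le> 4 * moment_gap p q x t"
      "(x - t)\<^sup>2 * x ^ (q - 2) \<le> 4 * moment_gap p q x t"
      by linarith+
    then show ?thesis using that by (auto simp: max_def)
  qed
  have neg: "moment_gap p q (- x) (- t) = moment_gap p q x t"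
    using assms \<open>odd (q - p)\<close> by (simp add: moment_gap_def)
  show ?thesis
  proof (cases "x * t \<ge> 0")
    case True
    then consider "x \<ge> 0" "t \<ge> 0" | "- x \<ge> 0" "- t \<ge> 0"
      by (auto simp: zero_le_mult_iff)
    then show ?thesis
    proof cases
      case 1
      then show ?thesis by (rule same)
    next
      case 2
      from same[OF this] show ?thesis by (simp add: neg power2_commute)
    qed
  next
    case False
    let ?M = "max \<bar>x\<bar> \<bar>t\<bar>"
    have "x ^ p * t ^ (q - p) \<le> 0"
      using False \<open>odd p\<close> \<open>odd (q - p)\<close>
      by (auto simp: zero_le_mult_iff mult_le_0_iff zero_le_power_eq power_le_zero_eq)
    then have "real q * x ^ p * t ^ (q - p) \<le> 0"
      by (simp add: mult.assoc mult_nonneg_nonpos)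
    moreover have "real p \<ge> 1" "real (q - p) \<ge> 1" using assms by auto
    then have "real p * x ^ q \<ge> 1 * x ^ q" "real (q - p) * t ^ q \<ge> 1 * t ^ q"
      using assms by (blast intro: mult_right_mono zero_le_even_power)+
    ultimately have "moment_gap p q x t \<ge> x ^ q + t ^ q" by (simp add: moment_gap_def)
    moreover have "x ^ q + t ^ q \<ge> ?M ^ q"
      using assms zero_le_even_power[of q x] zero_le_even_power[of q t]
      by (auto simp: max_def power_even_abs)
    moreover have "q = 2 + (q - 2)" using assms by simp
    then have "?M ^ q = ?M\<^sup>2 * ?M ^ (q - 2)" by (metis power_add)
    moreover have "(x - t)\<^sup>2 \<le> 4 * ?M\<^sup>2"
    proof -
      have "\<bar>x - t\<bar> \<le> 2 * ?M" by (auto simp: max_def)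
      from power_mono[OF this, of 2] show ?thesis by simp
    qed
    then have "(x - t)\<^sup>2 * ?M ^ (q - 2) \<le> 4 * ?M\<^sup>2 * ?M ^ (q - 2)"
      by (intro mult_right_mono) auto
    ultimately show ?thesis by linarith
  qed
qed

lemma abs_power_diff_le:
  fixes x t :: real
  assumes "\<bar>x\<bar> \<le> M" "\<bar>t\<bar> \<le> M"
  shows "\<bar>x ^ n - t ^ n\<bar> \<le> real n * M ^ (n - 1) * \<bar>x - t\<bar>"
proof -
  have M: "M \<ge> 0" using assms by linarith
  have "\<bar>\<Sum>i<n. t ^ (n - Suc i) * x ^ i\<bar> \<le> (\<Sum>i<n. M ^ (n - 1))"
  proof (rule order_trans[OF sum_abs], rule sum_mono)
    fix i assume "i \<in> {..<n}"
    then have "M ^ (n - 1) = M ^ (n - Suc i) * M ^ i" by (simp add: power_add[symmetric])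
    then show "\<bar>t ^ (n - Suc i) * x ^ i\<bar> \<le> M ^ (n - 1)"
      using assms M by (auto simp: abs_mult power_abs intro!: mult_mono power_mono)
  qed
  then have "\<bar>x - t\<bar> * \<bar>\<Sum>i<n. t ^ (n - Suc i) * x ^ i\<bar> \<le> \<bar>x - t\<bar> * (real n * M ^ (n - 1))"
    by (intro mult_left_mono) auto
  then show ?thesis
    by (simp add: power_diff_sumr2 abs_mult mult_ac)
qed

text \<open>At \<open>x = t = 0\<close> the gap vanishes to order \<open>q\<close>, which is where the restriction \<open>q \<le> 2n\<close> comes from.\<close>

lemma power_diff_square_le_moment_gap:
  fixes x t :: real
  assumes "0 < p" "p < q" "odd p" "even q" and "q \<le> 2 * n" and "\<bar>x\<bar> \<le> L" "\<bar>t\<bar> \<le> L"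
  shows "(x ^ n - t ^ n)\<^sup>2 \<le> 4 * (real n)\<^sup>2 * L ^ (2 * n - q) * moment_gap p q x t"
proof -
  let ?M = "max \<bar>x\<bar> \<bar>t\<bar>"
  have gap: "(x - t)\<^sup>2 * ?M ^ (q - 2) \<le> 4 * moment_gap p q x t"
    using moment_gap_ge assms by blast
  have "(n - 1) * 2 = (q - 2) + (2 * n - q)" using assms by simp
  then have M: "(?M ^ (n - 1))\<^sup>2 = ?M ^ (q - 2) * ?M ^ (2 * n - q)"
    by (simp only: power_mult[symmetric] power_add)
  have "(x ^ n - t ^ n)\<^sup>2 \<le> (real n * ?M ^ (n - 1) * \<bar>x - t\<bar>)\<^sup>2"
    using power_mono[OF abs_power_diff_le[of x ?M t n], of 2] by simp
  also have "\<dots> = (real n)\<^sup>2 * (?M ^ (2 * n - q) * ((x - t)\<^sup>2 * ?M ^ (q - 2)))"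
    by (simp only: power_mult_distrib M power2_abs mult_ac)
  also have "\<dots> \<le> (real n)\<^sup>2 * (L ^ (2 * n - q) * (4 * moment_gap p q x t))"
    using assms by (intro mult_left_mono mult_mono[OF power_mono gap]) auto
  finally show ?thesis by (simp add: mult_ac)
qed


section \<open>Operator remainders\<close>

lemma operator_power_diff_bound:
  assumes T: "bounded_operator T" and TR: "\<And>x. norm (T x) \<le> R * norm x" and "R \<ge> 0"
  shows "\<exists>C\<ge>0. \<forall>t h. \<bar>t\<bar> \<le> L \<longrightarrow> norm ((T ^^ n) h - (t ^ n) *\<^sub>R h) \<le> C * norm (T h - t *\<^sub>R h)"
proof (induction n)
  case 0
  show ?case by (intro exI[of _ 0]) simp
next
  case (Suc n)
  then obtain C where "C \<ge> 0" and C: "\<And>t h. \<bar>t\<bar> \<le> L \<Longrightarrow>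
      norm ((T ^^ n) h - (t ^ n) *\<^sub>R h) \<le> C * norm (T h - t *\<^sub>R h)"
    by blast
  show ?case
  proof (intro exI[of _ "R * C + \<bar>L\<bar> ^ n"] conjI allI impI)
    show "R * C + \<bar>L\<bar> ^ n \<ge> 0" using \<open>R \<ge> 0\<close> \<open>C \<ge> 0\<close> by simp
    fix t h assume t: "\<bar>t\<bar> \<le> L"
    have "(T ^^ Suc n) h - (t ^ Suc n) *\<^sub>R h = T ((T ^^ n) h - (t ^ n) *\<^sub>R h) + (t ^ n) *\<^sub>R (T h - t *\<^sub>R h)"
      by (simp add: bounded_operatorD[OF T] algebra_simps)
    also have "norm \<dots> \<le> R * (C * norm (T h - t *\<^sub>R h)) + \<bar>L\<bar> ^ n * norm (T h - t *\<^sub>R h)"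
    proof (rule norm_triangle_mono)
      show "norm (T ((T ^^ n) h - (t ^ n) *\<^sub>R h)) \<le> R * (C * norm (T h - t *\<^sub>R h))"
        using TR mult_left_mono[OF C[OF t] \<open>R \<ge> 0\<close>] order_trans by blast
      have "\<bar>t\<bar> ^ n \<le> \<bar>L\<bar> ^ n" using t by (intro power_mono) auto
      then show "norm ((t ^ n) *\<^sub>R (T h - t *\<^sub>R h)) \<le> \<bar>L\<bar> ^ n * norm (T h - t *\<^sub>R h)"
        by (simp add: power_abs mult_right_mono)
    qed
    finally show "norm ((T ^^ Suc n) h - (t ^ Suc n) *\<^sub>R h) \<le> (R * C + \<bar>L\<bar> ^ n) * norm (T h - t *\<^sub>R h)"
      by (simp add: algebra_simps)
  qed
qed

text \<open>Taylor's formula of order two at \<open>t\<close>, with the remainder \<open>T\<^sup>k - t\<^sup>k - k t\<^sup>k\<^sup>-\<^sup>1 (T - t)\<close> written as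
  \<open>(T - t) S\<^sub>k (T - t)\<close>, where \<open>S\<^sub>k\<^sub>+\<^sub>1 = T S\<^sub>k + k t\<^sup>k\<^sup>-\<^sup>1\<close>. What matters is that the bound on \<open>S\<^sub>k\<close> is
  uniform in \<open>t\<close>.\<close>

lemma operator_taylor_factorization:
  assumes T: "bounded_operator T" and TR: "\<And>x. norm (T x) \<le> R * norm x" and "R \<ge> 0"
  shows "\<exists>C\<ge>0. \<forall>t. \<bar>t\<bar> \<le> L \<longrightarrow> (\<exists>S. (\<forall>x. norm (S x) \<le> C * norm x) \<and>
    (\<forall>x. (T ^^ k) x - (t ^ k) *\<^sub>R x - (real k * t ^ (k - 1)) *\<^sub>R (T x - t *\<^sub>R x)
       = T (S (T x - t *\<^sub>R x)) - t *\<^sub>R S (T x - t *\<^sub>R x)))"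
proof (induction k)
  case 0
  show ?case
    by (intro exI[of _ 0] conjI allI impI exI[of _ "\<lambda>_. 0"]) (simp_all add: bounded_operatorD[OF T])
next
  case (Suc k)
  then obtain C where "C \<ge> 0" and C: "\<And>t. \<bar>t\<bar> \<le> L \<Longrightarrow> \<exists>S. (\<forall>x. norm (S x) \<le> C * norm x) \<and>
    (\<forall>x. (T ^^ k) x - (t ^ k) *\<^sub>R x - (real k * t ^ (k - 1)) *\<^sub>R (T x - t *\<^sub>R x)
       = T (S (T x - t *\<^sub>R x)) - t *\<^sub>R S (T x - t *\<^sub>R x))"
    by blast
  show ?case
  proof (intro exI[of _ "R * C + real k * \<bar>L\<bar> ^ (k - 1)"] conjI allI impI)
    show "R * C + real k * \<bar>L\<bar> ^ (k - 1) \<ge> 0" using \<open>R \<ge> 0\<close> \<open>C \<ge> 0\<close> by simp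
    fix t :: real assume t: "\<bar>t\<bar> \<le> L"
    obtain S where S: "\<And>x. norm (S x) \<le> C * norm x"
      and rem: "\<And>x. (T ^^ k) x - (t ^ k) *\<^sub>R x - (real k * t ^ (k - 1)) *\<^sub>R (T x - t *\<^sub>R x)
       = T (S (T x - t *\<^sub>R x)) - t *\<^sub>R S (T x - t *\<^sub>R x)"
      using C[OF t] by blast
    define c where "c = real k * t ^ (k - 1)"
    have ct: "real (Suc k) * t ^ k = c * t + t ^ k"
      by (cases k) (simp_all add: c_def algebra_simps)
    have "norm (T (S x) + c *\<^sub>R x) \<le> (R * C + real k * \<bar>L\<bar> ^ (k - 1)) * norm x" for x
    proof -
      have "norm (T (S x) + c *\<^sub>R x) \<le> R * (C * norm x) + real k * \<bar>L\<bar> ^ (k - 1) * norm x"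
      proof (rule norm_triangle_mono)
        show "norm (T (S x)) \<le> R * (C * norm x)"
          using TR mult_left_mono[OF S \<open>R \<ge> 0\<close>] order_trans by blast
        have "\<bar>t\<bar> ^ (k - 1) \<le> \<bar>L\<bar> ^ (k - 1)" using t by (intro power_mono) auto
        then show "norm (c *\<^sub>R x) \<le> real k * \<bar>L\<bar> ^ (k - 1) * norm x"
          by (simp add: c_def abs_mult power_abs mult_left_mono mult_right_mono)
      qed
      then show ?thesis by (simp add: algebra_simps)
    qed
    moreover have "(T ^^ Suc k) x - (t ^ Suc k) *\<^sub>R x - (real (Suc k) * t ^ (Suc k - 1)) *\<^sub>R (T x - t *\<^sub>R x)
       = T (T (S (T x - t *\<^sub>R x)) + c *\<^sub>R (T x - t *\<^sub>R x))
         - t *\<^sub>R (T (S (T x - t *\<^sub>R x)) + c *\<^sub>R (T x - t *\<^sub>R x))" for x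
    proof -
      have "(T ^^ Suc k) x = T ((T (S (T x - t *\<^sub>R x)) - t *\<^sub>R S (T x - t *\<^sub>R x))
          + (t ^ k) *\<^sub>R x + c *\<^sub>R (T x - t *\<^sub>R x))"
        by (simp add: rem[symmetric] c_def)
      then show ?thesis
        by (simp add: ct bounded_operatorD[OF T] algebra_simps del: of_nat_Suc)
    qed
    ultimately show "\<exists>S. (\<forall>x. norm (S x) \<le> (R * C + real k * \<bar>L\<bar> ^ (k - 1)) * norm x) \<and>
      (\<forall>x. (T ^^ Suc k) x - (t ^ Suc k) *\<^sub>R x - (real (Suc k) * t ^ (Suc k - 1)) *\<^sub>R (T x - t *\<^sub>R x)
         = T (S (T x - t *\<^sub>R x)) - t *\<^sub>R S (T x - t *\<^sub>R x))"
      by (intro exI[of _ "\<lambda>x. T (S x) + c *\<^sub>R x"]) blast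
  qed
qed

lemma operator_taylor_bound:
  assumes T: "selfadjoint T" and TR: "\<And>x. norm (T x) \<le> R * norm x" and "R \<ge> 0"
  shows "\<exists>C\<ge>0. \<forall>t h. \<bar>t\<bar> \<le> L \<longrightarrow>
    \<bar>Re (cinner ((T ^^ k) h) h) - t ^ k * (norm h)\<^sup>2
      - real k * t ^ (k - 1) * (Re (cinner (T h) h) - t * (norm h)\<^sup>2)\<bar> \<le> C * (norm (T h - t *\<^sub>R h))\<^sup>2"
proof -
  note bT = selfadjoint_bounded_operator[OF T]
  obtain C where "C \<ge> 0" and C: "\<And>t. \<bar>t\<bar> \<le> L \<Longrightarrow> \<exists>S. (\<forall>x. norm (S x) \<le> C * norm x) \<and>
    (\<forall>x. (T ^^ k) x - (t ^ k) *\<^sub>R x - (real k * t ^ (k - 1)) *\<^sub>R (T x - t *\<^sub>R x)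
       = T (S (T x - t *\<^sub>R x)) - t *\<^sub>R S (T x - t *\<^sub>R x))"
    using operator_taylor_factorization[OF bT TR \<open>R \<ge> 0\<close>] by blast
  have "\<bar>Re (cinner ((T ^^ k) h) h) - t ^ k * (norm h)\<^sup>2
      - real k * t ^ (k - 1) * (Re (cinner (T h) h) - t * (norm h)\<^sup>2)\<bar> \<le> C * (norm (T h - t *\<^sub>R h))\<^sup>2"
    if t: "\<bar>t\<bar> \<le> L" for t h
  proof -
    obtain S where S: "\<And>x. norm (S x) \<le> C * norm x"
      and rem: "\<And>x. (T ^^ k) x - (t ^ k) *\<^sub>R x - (real k * t ^ (k - 1)) *\<^sub>R (T x - t *\<^sub>R x)
       = T (S (T x - t *\<^sub>R x)) - t *\<^sub>R S (T x - t *\<^sub>R x)"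
      using C[OF t] by blast
    let ?k = "T h - t *\<^sub>R h"
    have "Re (cinner ((T ^^ k) h) h) - t ^ k * (norm h)\<^sup>2
        - real k * t ^ (k - 1) * (Re (cinner (T h) h) - t * (norm h)\<^sup>2)
      = Re (cinner ((T ^^ k) h - (t ^ k) *\<^sub>R h - (real k * t ^ (k - 1)) *\<^sub>R ?k) h)"
      by (simp add: cinner_algebra Re_cinner_self)
    also have "\<dots> = Re (cinner (S ?k) ?k)"
      unfolding rem by (simp add: cinner_algebra selfadjoint_cinner[OF T])
    also have "\<bar>\<dots>\<bar> \<le> norm (S ?k) * norm ?k" by (rule abs_Re_cinner_le_norm)
    also have "\<dots> \<le> C * norm ?k * norm ?k" using S by (intro mult_right_mono) auto
    finally show ?thesis by (simp add: power2_eq_square mult.assoc)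
  qed
  with \<open>C \<ge> 0\<close> show ?thesis by blast
qed

text \<open>The gap of \<open>T\<close> at \<open>t\<close> is a combination of Taylor remainders in which the linear terms cancel.\<close>

lemma operator_moment_gap_bound:
  assumes T: "selfadjoint T" and TR: "\<And>x. norm (T x) \<le> R * norm x" and "R \<ge> 0" and "0 < p" "p < q"
  shows "\<exists>C\<ge>0. \<forall>t h. \<bar>t\<bar> \<le> L \<longrightarrow>
    real p * Re (cinner ((T ^^ q) h) h) - real q * t ^ (q - p) * Re (cinner ((T ^^ p) h) h)
      + real (q - p) * t ^ q * (norm h)\<^sup>2 \<le> C * (norm (T h - t *\<^sub>R h))\<^sup>2"
proof -
  define rem where "rem k t h = Re (cinner ((T ^^ k) h) h) - t ^ k * (norm h)\<^sup>2
      - real k * t ^ (k - 1) * (Re (cinner (T h) h) - t * (norm h)\<^sup>2)" for k t h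
  have "\<exists>C\<ge>0. \<forall>t h. \<bar>t\<bar> \<le> L \<longrightarrow> \<bar>rem k t h\<bar> \<le> C * (norm (T h - t *\<^sub>R h))\<^sup>2" for k
    unfolding rem_def using operator_taylor_bound[OF T TR \<open>R \<ge> 0\<close>] .
  then obtain C where C0: "\<And>k. C k \<ge> 0"
    and C: "\<And>k t h. \<bar>t\<bar> \<le> L \<Longrightarrow> \<bar>rem k t h\<bar> \<le> C k * (norm (T h - t *\<^sub>R h))\<^sup>2"
    by metis
  show ?thesis
  proof (intro exI[of _ "real p * C q + real q * \<bar>L\<bar> ^ (q - p) * C p"] conjI allI impI)
    show "0 \<le> real p * C q + real q * \<bar>L\<bar> ^ (q - p) * C p" using C0 by simp
    fix t h assume t: "\<bar>t\<bar> \<le> L"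
    have e: "q - p + p = q" "q - p + (p - 1) = q - 1" using \<open>0 < p\<close> \<open>p < q\<close> by simp_all
    have pw: "t ^ (q - p) * t ^ p = t ^ q" "t ^ (q - p) * t ^ (p - 1) = t ^ (q - 1)"
      by (simp_all only: power_add[symmetric] e)
    have "real p * Re (cinner ((T ^^ q) h) h) - real q * t ^ (q - p) * Re (cinner ((T ^^ p) h) h)
        + real (q - p) * t ^ q * (norm h)\<^sup>2
      = real p * rem q t h - real q * t ^ (q - p) * rem p t h"
    proof -
      have "real q * t ^ (q - p) * rem p t h = real q * t ^ (q - p) * Re (cinner ((T ^^ p) h) h)
          - real q * (t ^ (q - p) * t ^ p) * (norm h)\<^sup>2
          - real q * real p * (t ^ (q - p) * t ^ (p - 1)) * (Re (cinner (T h) h) - t * (norm h)\<^sup>2)"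
        by (simp add: rem_def algebra_simps)
      then show ?thesis
        unfolding pw using \<open>p < q\<close> by (simp add: rem_def algebra_simps of_nat_diff)
    qed
    also have "\<dots> \<le> real p * \<bar>rem q t h\<bar> + real q * \<bar>t\<bar> ^ (q - p) * \<bar>rem p t h\<bar>"
    proof -
      have "- (real q * t ^ (q - p) * rem p t h) \<le> \<bar>real q * t ^ (q - p) * rem p t h\<bar>" by linarith
      moreover have "real p * rem q t h \<le> real p * \<bar>rem q t h\<bar>" by (intro mult_left_mono) auto
      ultimately show ?thesis by (simp add: abs_mult power_abs)
    qed
    also have "\<dots> \<le> real p * (C q * (norm (T h - t *\<^sub>R h))\<^sup>2)
        + real q * \<bar>L\<bar> ^ (q - p) * (C p * (norm (T h - t *\<^sub>R h))\<^sup>2)"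
      using C[OF t] t by (intro add_mono mult_left_mono mult_mono power_mono) auto
    finally show "real p * Re (cinner ((T ^^ q) h) h) - real q * t ^ (q - p) * Re (cinner ((T ^^ p) h) h)
        + real (q - p) * t ^ q * (norm h)\<^sup>2
      \<le> (real p * C q + real q * \<bar>L\<bar> ^ (q - p) * C p) * (norm (T h - t *\<^sub>R h))\<^sup>2"
      by (simp add: algebra_simps)
  qed
qed


section \<open>Integration of bounded Borel functions\<close>

definition bounded_borel :: "(real \<Rightarrow> complex) \<Rightarrow> bool" where
  "bounded_borel f \<longleftrightarrow> f \<in> borel_measurable borel \<and> bounded (range f)"

lemma bounded_borelI:
  "f \<in> borel_measurable borel \<Longrightarrow> (\<And>x. cmod (f x) \<le> B) \<Longrightarrow> bounded_borel f"
  unfolding bounded_borel_def bounded_iff by auto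

lemma bounded_borelE:
  assumes "bounded_borel f"
  obtains B where "f \<in> borel_measurable borel" "\<And>x. cmod (f x) \<le> B" "B \<ge> 0"
proof -
  obtain B where "\<And>x. cmod (f x) \<le> B"
    using assms unfolding bounded_borel_def bounded_iff by auto
  moreover from this[of 0] have "B \<ge> 0" using norm_ge_zero order_trans by blast
  ultimately show thesis using assms that unfolding bounded_borel_def by blast
qed

lemma bounded_borel_measurable: "bounded_borel f \<Longrightarrow> f \<in> borel_measurable borel"
  by (simp add: bounded_borel_def)

lemma bounded_borel_const: "bounded_borel (\<lambda>_. c)"
  by (rule bounded_borelI[of _ "cmod c"]) auto

lemma bounded_borel_add:
  assumes "bounded_borel f" "bounded_borel g" shows "bounded_borel (\<lambda>x. f x + g x)"
proof -
  obtain B where B: "f \<in> borel_measurable borel" "\<And>x. cmod (f x) \<le> B"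
    using bounded_borelE[OF assms(1)] by metis
  obtain C where C: "g \<in> borel_measurable borel" "\<And>x. cmod (g x) \<le> C"
    using bounded_borelE[OF assms(2)] by metis
  show ?thesis using B C by (intro bounded_borelI[of _ "B + C"] norm_triangle_mono) auto
qed

lemma bounded_borel_mult:
  assumes "bounded_borel f" "bounded_borel g" shows "bounded_borel (\<lambda>x. f x * g x)"
proof -
  obtain B where B: "f \<in> borel_measurable borel" "\<And>x. cmod (f x) \<le> B" "B \<ge> 0"
    using bounded_borelE[OF assms(1)] by metis
  obtain C where C: "g \<in> borel_measurable borel" "\<And>x. cmod (g x) \<le> C"
    using bounded_borelE[OF assms(2)] by metis
  show ?thesis using B C
    by (intro bounded_borelI[of _ "B * C"]) (auto simp: norm_mult intro!: mult_mono)
qed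

lemma bounded_borel_power: "bounded_borel f \<Longrightarrow> bounded_borel (\<lambda>x. f x ^ k)"
  by (induction k) (simp_all add: bounded_borel_const bounded_borel_mult)

lemma bounded_borel_diff:
  assumes "bounded_borel f" "bounded_borel g" shows "bounded_borel (\<lambda>x. f x - g x)"
proof -
  have "bounded_borel (\<lambda>x. f x + (-1) * g x)"
    by (intro bounded_borel_add bounded_borel_mult bounded_borel_const assms)
  then show ?thesis by simp
qed

lemma bounded_borel_indicator: "\<Delta> \<in> sets borel \<Longrightarrow> bounded_borel (indicator \<Delta>)"
  by (rule bounded_borelI[of _ 1]) (simp_all add: indicator_def)

lemma bounded_borel_if_simple:
  assumes "simple_function borel f" shows "bounded_borel f"
  unfolding bounded_borel_def
  using simple_functionD(1)[OF assms] borel_measurable_simple_function[OF assms]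
  by (metis finite_imp_bounded space_borel)

lemma bounded_borel_limit:
  assumes "\<And>n. bounded_borel (f n)" "\<And>n x. cmod (f n x) \<le> K" "\<And>x. (\<lambda>n. f n x) \<longlonglongrightarrow> g x"
  shows "bounded_borel g"
proof (rule bounded_borelI)
  show "g \<in> borel_measurable borel"
    by (rule borel_measurable_LIMSEQ_metric[of f, OF bounded_borel_measurable[OF assms(1)] assms(3)])
  show "cmod (g x) \<le> K" for x
    using tendsto_norm[OF assms(3)] by (rule LIMSEQ_le_const2) (use assms(2) in auto)
qed

locale semispectral =
  fixes F :: "real set \<Rightarrow> 'a::complex_hilbert \<Rightarrow> 'a"
  assumes semispectral: "semispectral_measure F"
begin

lemma bounded_operator_F: "\<Delta> \<in> sets borel \<Longrightarrow> bounded_operator (F \<Delta>)"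
  using semispectral by (simp add: semispectral_measure_def)

lemma selfadjoint_F: "\<Delta> \<in> sets borel \<Longrightarrow> selfadjoint (F \<Delta>)"
  using semispectral by (auto simp: semispectral_measure_def intro: selfadjointI_real)

lemma F_nonneg: "\<Delta> \<in> sets borel \<Longrightarrow> 0 \<le> Re (cinner (F \<Delta> h) h)"
  using semispectral by (auto simp: semispectral_measure_def)

lemma sets_scalar_measure [simp, measurable_cong]: "sets (scalar_measure F h) = sets borel"
  and space_scalar_measure [simp]: "space (scalar_measure F h) = UNIV"
  using sets.space_closed[of borel] sets.sigma_sets_eq[of borel]
  by (simp_all add: scalar_measure_def)

lemma emeasure_scalar_measure:
  assumes "\<Delta> \<in> sets borel"
  shows "emeasure (scalar_measure F h) \<Delta> = ennreal (Re (cinner (F \<Delta> h) h))"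
proof -
  have "measure_space UNIV (sets borel) (\<lambda>\<Delta>. ennreal (Re (cinner (F \<Delta> h) h)))"
    using semispectral by (simp add: semispectral_measure_def)
  then show ?thesis
    unfolding scalar_measure_def measure_space_def using assms
    by (intro emeasure_measure_of_sigma) auto
qed

lemma measure_scalar_measure:
  "\<Delta> \<in> sets borel \<Longrightarrow> measure (scalar_measure F h) \<Delta> = Re (cinner (F \<Delta> h) h)"
  by (simp add: measure_def emeasure_scalar_measure F_nonneg)

lemma measure_scalar_measure_UNIV: "measure (scalar_measure F h) UNIV = (norm h)\<^sup>2"
proof -
  have "F UNIV = id" using semispectral by (simp add: semispectral_measure_def)
  then show ?thesis by (simp add: measure_scalar_measure Re_cinner_self)
qed

lemma finite_scalar_measure: "finite_measure (scalar_measure F h)"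
  by (rule finite_measureI) (simp add: emeasure_scalar_measure)

lemma integrable_scalar_measure:
  fixes f :: "real \<Rightarrow> 'b::{banach, second_countable_topology}"
  assumes "f \<in> borel_measurable borel" "\<And>x. norm (f x) \<le> B"
  shows "integrable (scalar_measure F h) f"
  by (rule finite_measure.integrable_const_bound[OF finite_scalar_measure, of _ B]) (use assms in auto)

lemma integrable_bounded_borel:
  assumes "bounded_borel f"
  shows "integrable (scalar_measure F h) f" "integrable (scalar_measure F h) (\<lambda>x. (cmod (f x))\<^sup>2)"
proof -
  obtain B where B: "f \<in> borel_measurable borel" "\<And>x. cmod (f x) \<le> B"
    using bounded_borelE[OF assms] by metis
  then show "integrable (scalar_measure F h) f" by (rule integrable_scalar_measure)
  show "integrable (scalar_measure F h) (\<lambda>x. (cmod (f x))\<^sup>2)"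
    by (rule integrable_scalar_measure[of _ "B\<^sup>2"]) (use B in \<open>auto intro!: power_mono\<close>)
qed

lemma integral_tendsto_bounded:
  fixes f :: "nat \<Rightarrow> real \<Rightarrow> 'b::{banach, second_countable_topology}"
  assumes "\<And>n. f n \<in> borel_measurable borel" "\<And>n x. norm (f n x) \<le> K"
    and "\<And>x. (\<lambda>n. f n x) \<longlonglongrightarrow> g x"
  shows "(\<lambda>n. LINT x|scalar_measure F h. f n x) \<longlonglongrightarrow> (LINT x|scalar_measure F h. g x)"
proof (rule integral_dominated_convergence[where w = "\<lambda>_. K"])
  show "g \<in> borel_measurable (scalar_measure F h)"
    using borel_measurable_LIMSEQ_metric[of f borel g] assms by simp
  show "integrable (scalar_measure F h) (\<lambda>_. K)"
    by (rule integrable_scalar_measure[of _ "\<bar>K\<bar>"]) auto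
qed (use assms in auto)

lemma semispectral_integral_eqI:
  assumes "bounded_operator A" "\<And>h. cinner (A h) h = (LINT x|scalar_measure F h. f x)"
  shows "semispectral_integral F f = A"
  unfolding semispectral_integral_def
  by (rule the_equality) (use assms in \<open>auto intro: bounded_operator_eqI\<close>)

text \<open>For a simple function with values \<open>c\<close> on \<open>\<Delta>\<^sub>c\<close>, the operator is \<open>A = \<Sum> c F(\<Delta>\<^sub>c)\<close>. Summing
  \<open>0 \<le> \<langle>F(\<Delta>\<^sub>c)(c h - k), c h - k\<rangle>\<close> over \<open>c\<close> gives
  \<open>0 \<le> \<integral>|f|\<^sup>2 d\<langle>F h, h\<rangle> - 2 Re \<langle>A h, k\<rangle> + \<parallel>k\<parallel>\<^sup>2\<close>, and \<open>k = A h\<close> yields the Schwarz inequality. This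
  replaces the use of a dilation of \<open>F\<close> to a spectral measure.\<close>

lemma simple_integral_exists:
  assumes f: "simple_function borel f"
  shows "\<exists>A. bounded_operator A \<and> (\<forall>h. cinner (A h) h = (LINT x|scalar_measure F h. f x) \<and>
           (norm (A h))\<^sup>2 \<le> (LINT x|scalar_measure F h. (cmod (f x))\<^sup>2))"
proof -
  define V where "V = range f"
  define D where "D c = f -` {c}" for c
  have fin: "finite V" and D: "\<And>c. D c \<in> sets borel"
    using f simple_functionD(2)[OF f, of "{_}"] by (auto simp: simple_function_def V_def D_def)
  have rep: "g (f x) = (\<Sum>c\<in>V. indicator (D c) x *\<^sub>R g c)" for g :: "complex \<Rightarrow> 'b::real_vector" and x
  proof -
    have "(\<Sum>c\<in>V. indicator (D c) x *\<^sub>R g c) = (\<Sum>c\<in>V. if c = f x then g c else 0)"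
      by (rule sum.cong) (auto simp: D_def indicator_def)
    also have "\<dots> = g (f x)" using fin by (simp add: V_def)
    finally show ?thesis by simp
  qed
  have int: "(LINT x|scalar_measure F h. g (f x)) = (\<Sum>c\<in>V. Re (cinner (F (D c) h) h) *\<^sub>R g c)"
    for g :: "complex \<Rightarrow> 'b::{banach, second_countable_topology}" and h
  proof -
    have "(LINT x|scalar_measure F h. g (f x)) = (LINT x|scalar_measure F h. (\<Sum>c\<in>V. indicator (D c) x *\<^sub>R g c))"
      by (subst rep) simp
    also have "\<dots> = (\<Sum>c\<in>V. (LINT x|scalar_measure F h. indicator (D c) x *\<^sub>R g c))"
      by (rule Bochner_Integration.integral_sum)
        (use D in \<open>auto intro!: integrable_scalar_measure[of _ "norm (g _)"] simp: indicator_def\<close>)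
    also have "\<dots> = (\<Sum>c\<in>V. measure (scalar_measure F h) (D c) *\<^sub>R g c)"
      using D finite_measure.emeasure_finite[OF finite_scalar_measure]
      by (intro sum.cong refl) (simp add: top.not_eq_extremum)
    finally show ?thesis using D by (simp add: measure_scalar_measure)
  qed
  define A where "A h = (\<Sum>c\<in>V. c *\<^sub>C F (D c) h)" for h
  have "bounded_operator A"
    unfolding A_def[abs_def] using D
    by (intro bounded_operator_sum bounded_operator_scaleC bounded_operator_F)
  moreover have "cinner (A h) h = (LINT x|scalar_measure F h. f x)" for h
  proof -
    have "cinner (A h) h = (\<Sum>c\<in>V. c * cinner (F (D c) h) h)"
      by (simp add: A_def cinner_sum_left cinner_algebra)
    also have "\<dots> = (\<Sum>c\<in>V. Re (cinner (F (D c) h) h) *\<^sub>R c)"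
      by (intro sum.cong refl)
        (metis D selfadjoint_F selfadjoint_cinner_real scaleR_conv_of_real mult.commute)
    finally show ?thesis using int[of h "\<lambda>c. c"] by simp
  qed
  moreover have "(norm (A h))\<^sup>2 \<le> (LINT x|scalar_measure F h. (cmod (f x))\<^sup>2)" for h
  proof -
    let ?k = "A h"
    have expand: "Re (cinner (F (D c) (c *\<^sub>C h - ?k)) (c *\<^sub>C h - ?k)) =
        Re (cinner (F (D c) h) h) * (cmod c)\<^sup>2 - 2 * Re (c * cinner (F (D c) h) ?k)
        + Re (cinner (F (D c) ?k) ?k)" for c
    proof -
      note F = bounded_operatorD[OF bounded_operator_F[OF D[of c]]]
      have "cinner (F (D c) h) h = of_real (Re (cinner (F (D c) h) h))"
        by (rule selfadjoint_cinner_real) (rule selfadjoint_F, rule D)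
      then have "Re (c * (cnj c * cinner (F (D c) h) h)) = Re (cinner (F (D c) h) h) * (cmod c)\<^sup>2"
        by (metis complex_norm_square mult.assoc mult.commute Re_complex_of_real of_real_mult)
      moreover have "cinner (F (D c) ?k) h = cnj (cinner (F (D c) h) ?k)"
        using cinner_commute selfadjoint_cinner[OF selfadjoint_F[OF D]] by metis
      ultimately show ?thesis
        by (simp add: F cinner_algebra algebra_simps)
    qed
    have "0 \<le> (\<Sum>c\<in>V. Re (cinner (F (D c) (c *\<^sub>C h - ?k)) (c *\<^sub>C h - ?k)))"
      by (intro sum_nonneg F_nonneg D)
    also have "\<dots> = (\<Sum>c\<in>V. Re (cinner (F (D c) h) h) *\<^sub>R (cmod c)\<^sup>2)
        - 2 * Re (\<Sum>c\<in>V. c * cinner (F (D c) h) ?k) + (\<Sum>c\<in>V. Re (cinner (F (D c) ?k) ?k) *\<^sub>R 1)"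
      by (simp add: expand sum.distrib sum_subtractf sum_distrib_left)
    also have "(\<Sum>c\<in>V. c * cinner (F (D c) h) ?k) = cinner ?k ?k"
      by (subst (2) A_def) (simp add: cinner_sum_left cinner_algebra)
    also have "(\<Sum>c\<in>V. Re (cinner (F (D c) ?k) ?k) *\<^sub>R 1) = (norm ?k)\<^sup>2"
      using int[of ?k "\<lambda>_. 1 :: real"] by (simp add: measure_scalar_measure_UNIV)
    also have "(\<Sum>c\<in>V. Re (cinner (F (D c) h) h) *\<^sub>R (cmod c)\<^sup>2) =
        (LINT x|scalar_measure F h. (cmod (f x))\<^sup>2)"
      by (rule int[of h "\<lambda>c. (cmod c)\<^sup>2", symmetric])
    finally show ?thesis by (simp add: Re_cinner_self)
  qed
  ultimately show ?thesis by blast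
qed

text \<open>The Schwarz inequality makes the operators of approximating simple functions a strong Cauchy
  sequence, so completeness of the space provides the operator in the general case.\<close>

lemma integral_exists:
  assumes f: "bounded_borel f"
  shows "\<exists>A. bounded_operator A \<and> (\<forall>h. cinner (A h) h = (LINT x|scalar_measure F h. f x) \<and>
           (norm (A h))\<^sup>2 \<le> (LINT x|scalar_measure F h. (cmod (f x))\<^sup>2))"
proof -
  obtain B where B: "f \<in> borel_measurable borel" "\<And>x. cmod (f x) \<le> B" "B \<ge> 0"
    using bounded_borelE[OF f] by metis
  obtain s where s: "\<And>i. simple_function borel (s i)" "\<And>x. (\<lambda>i. s i x) \<longlonglongrightarrow> f x"
      "\<And>i x. dist (s i x) 0 \<le> 2 * dist (f x) 0"
    using borel_measurable_implies_sequence_metric[OF B(1), of 0] by auto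
  have sB: "cmod (s i x) \<le> 2 * B" for i x
    using s(3)[of i x] B(2)[of x] by simp
  have sm: "s i \<in> borel_measurable borel" for i
    using s(1) by (rule borel_measurable_simple_function)
  obtain A where A: "\<And>i. bounded_operator (A i)"
      "\<And>i h. cinner (A i h) h = (LINT x|scalar_measure F h. s i x)"
      "\<And>i h. (norm (A i h))\<^sup>2 \<le> (LINT x|scalar_measure F h. (cmod (s i x))\<^sup>2)"
    using simple_integral_exists[OF s(1)] by metis
  define e where "e h i = (LINT x|scalar_measure F h. (cmod (s i x - f x))\<^sup>2)" for h i
  have e0: "e h \<longlonglongrightarrow> 0" for h
  proof -
    have "(\<lambda>i. LINT x|scalar_measure F h. (cmod (s i x - f x))\<^sup>2) \<longlonglongrightarrow> (LINT x|scalar_measure F h. 0)"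
    proof (rule integral_tendsto_bounded)
      show "(\<lambda>x. (cmod (s i x - f x))\<^sup>2) \<in> borel_measurable borel" for i
        using sm[of i] B(1) by measurable
      have "cmod (s i x - f x) \<le> 3 * B" for i x
        using norm_triangle_ineq4[of "s i x" "f x"] sB[of i x] B(2)[of x] by linarith
      from power_mono[OF this norm_ge_zero, where n = 2]
      show "norm ((cmod (s i x - f x))\<^sup>2) \<le> (3 * B)\<^sup>2" for i x by simp
      show "(\<lambda>i. (cmod (s i x - f x))\<^sup>2) \<longlonglongrightarrow> 0" for x
        using tendsto_power[OF tendsto_norm[OF LIM_zero[OF s(2)[of x]]], of 2] by simp
    qed
    then show ?thesis by (simp add: e_def[abs_def])
  qed
  have diff: "(norm (A i h - A j h))\<^sup>2 \<le> 2 * e h i + 2 * e h j" for i j h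
  proof -
    have simp: "simple_function borel (\<lambda>x. s i x - s j x)"
      using s(1) by (intro simple_function_diff)
    obtain A' where A': "bounded_operator A'"
        "\<And>h. cinner (A' h) h = (LINT x|scalar_measure F h. s i x - s j x)"
        "\<And>h. (norm (A' h))\<^sup>2 \<le> (LINT x|scalar_measure F h. (cmod (s i x - s j x))\<^sup>2)"
      using simple_integral_exists[OF simp] by metis
    have "A' = (\<lambda>h. A i h - A j h)"
      by (rule bounded_operator_eqI)
        (auto simp: A A' cinner_diff_left bounded_operator_diff
          Bochner_Integration.integral_diff integrable_scalar_measure[OF sm sB])
    then have "(norm (A i h - A j h))\<^sup>2 \<le> (LINT x|scalar_measure F h. (cmod (s i x - s j x))\<^sup>2)"
      using A'(3)[of h] by simp
    also have "\<dots> \<le> (LINT x|scalar_measure F h. 2 * (cmod (s i x - f x))\<^sup>2 + 2 * (cmod (s j x - f x))\<^sup>2)"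
    proof (rule integral_mono)
      have bs: "bounded_borel (s i)" for i using s(1) by (rule bounded_borel_if_simple)
      show "integrable (scalar_measure F h) (\<lambda>x. (cmod (s i x - s j x))\<^sup>2)"
        by (intro integrable_bounded_borel bounded_borel_diff bs)
      show "integrable (scalar_measure F h) (\<lambda>x. 2 * (cmod (s i x - f x))\<^sup>2 + 2 * (cmod (s j x - f x))\<^sup>2)"
        by (intro Bochner_Integration.integrable_add integrable_mult_right integrable_bounded_borel
            bounded_borel_diff bs f)
      fix x
      have "cmod (s i x - s j x) \<le> cmod (s i x - f x) + cmod (s j x - f x)"
        using norm_triangle_ineq4[of "s i x - f x" "s j x - f x"] by simp
      from power_mono[OF this norm_ge_zero, where n = 2]
      show "(cmod (s i x - s j x))\<^sup>2 \<le> 2 * (cmod (s i x - f x))\<^sup>2 + 2 * (cmod (s j x - f x))\<^sup>2"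
        using zero_le_power2[of "cmod (s i x - f x) - cmod (s j x - f x)"]
        by (simp add: power2_eq_square algebra_simps)
    qed
    also have "\<dots> = 2 * e h i + 2 * e h j"
      unfolding e_def
      by (subst Bochner_Integration.integral_add)
        (simp_all add: integrable_bounded_borel bounded_borel_diff f bounded_borel_if_simple[OF s(1)])
    finally show ?thesis .
  qed
  have "Cauchy (\<lambda>i. A i h)" for h
  proof (rule metric_CauchyI)
    fix r :: real assume "r > 0"
    then have "\<forall>\<^sub>F i in sequentially. e h i < r\<^sup>2 / 4"
      by (intro order_tendstoD(2)[OF e0]) simp
    then obtain M where M: "\<And>i. i \<ge> M \<Longrightarrow> e h i < r\<^sup>2 / 4"
      unfolding eventually_sequentially by blast
    have "dist (A i h) (A j h) < r" if "i \<ge> M" "j \<ge> M" for i j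
    proof -
      have "(norm (A i h - A j h))\<^sup>2 < r\<^sup>2"
        using diff[of i h j] M[OF that(1)] M[OF that(2)] by linarith
      then show ?thesis using \<open>r > 0\<close> by (simp add: dist_norm power_less_imp_less_base)
    qed
    then show "\<exists>M. \<forall>i\<ge>M. \<forall>j\<ge>M. dist (A i h) (A j h) < r" by blast
  qed
  then have conv: "(\<lambda>i. A i h) \<longlonglongrightarrow> lim (\<lambda>i. A i h)" for h
    by (simp add: Cauchy_convergent_iff convergent_LIMSEQ_iff)
  define L where "L h = lim (\<lambda>i. A i h)" for h
  have lim: "(\<lambda>i. A i h) \<longlonglongrightarrow> L h" for h using conv by (simp add: L_def)
  have cin: "cinner (L h) h = (LINT x|scalar_measure F h. f x)" for h
  proof (rule LIMSEQ_unique)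
    show "(\<lambda>i. cinner (A i h) h) \<longlonglongrightarrow> cinner (L h) h"
      by (rule cinner_tendsto_left[OF lim])
    show "(\<lambda>i. cinner (A i h) h) \<longlonglongrightarrow> (LINT x|scalar_measure F h. f x)"
      unfolding A using sm sB s(2) by (rule integral_tendsto_bounded)
  qed
  have Schwarz: "(norm (L h))\<^sup>2 \<le> (LINT x|scalar_measure F h. (cmod (f x))\<^sup>2)" for h
  proof (rule LIMSEQ_le)
    show "(\<lambda>i. (norm (A i h))\<^sup>2) \<longlonglongrightarrow> (norm (L h))\<^sup>2"
      by (intro tendsto_power tendsto_norm lim)
    show "(\<lambda>i. LINT x|scalar_measure F h. (cmod (s i x))\<^sup>2) \<longlonglongrightarrow> (LINT x|scalar_measure F h. (cmod (f x))\<^sup>2)"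
    proof (rule integral_tendsto_bounded)
      show "norm ((cmod (s i x))\<^sup>2) \<le> (2 * B)\<^sup>2" for i x
        using power_mono[OF sB norm_ge_zero, where n = 2] by simp
      show "(\<lambda>i. (cmod (s i x))\<^sup>2) \<longlonglongrightarrow> (cmod (f x))\<^sup>2" for x
        by (intro tendsto_power tendsto_norm s)
    qed (use sm in measurable)
  qed (use A(3) in blast)
  have "bounded_operator L"
    unfolding bounded_operator_def
  proof (intro conjI allI)
    show "bounded_linear L"
    proof (rule bounded_linear_intro)
      show "L (x + y) = L x + L y" for x y
      proof (rule LIMSEQ_unique[OF lim])
        show "(\<lambda>i. A i (x + y)) \<longlonglongrightarrow> L x + L y"
          unfolding bounded_operatorD(1)[OF A(1)] by (intro tendsto_add lim)
      qed
      show "L (r *\<^sub>R x) = r *\<^sub>R L x" for r x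
      proof (rule LIMSEQ_unique[OF lim])
        show "(\<lambda>i. A i (r *\<^sub>R x)) \<longlonglongrightarrow> r *\<^sub>R L x"
          unfolding bounded_operatorD(3)[OF A(1)] by (intro tendsto_scaleR tendsto_const lim)
      qed
      show "norm (L x) \<le> norm x * B" for x
      proof -
        have "(norm (L x))\<^sup>2 \<le> (LINT y|scalar_measure F x. B\<^sup>2)"
          by (rule order_trans[OF Schwarz integral_mono])
            (use f B in \<open>auto intro!: integrable_bounded_borel integrable_scalar_measure power_mono\<close>)
        also have "\<dots> = (norm x * B)\<^sup>2"
          by (simp add: measure_scalar_measure_UNIV power_mult_distrib)
        finally show ?thesis by (rule power2_le_imp_le) (use B(3) in simp)
      qed
    qed
    show "L (c *\<^sub>C x) = c *\<^sub>C L x" for c x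
    proof (rule LIMSEQ_unique[OF lim])
      show "(\<lambda>i. A i (c *\<^sub>C x)) \<longlonglongrightarrow> c *\<^sub>C L x"
        unfolding bounded_operatorD(4)[OF A(1)]
        by (rule bounded_linear.tendsto[OF bounded_linear_scaleC lim])
    qed
  qed
  then show ?thesis using cin Schwarz by blast
qed

lemma
  assumes "bounded_borel f"
  shows bounded_operator_integral: "bounded_operator (semispectral_integral F f)"
    and cinner_integral: "cinner (semispectral_integral F f h) h = (LINT x|scalar_measure F h. f x)"
    and norm_integral_Schwarz:
      "(norm (semispectral_integral F f h))\<^sup>2 \<le> (LINT x|scalar_measure F h. (cmod (f x))\<^sup>2)"
proof -
  obtain A where A: "bounded_operator A"
      "\<And>h. cinner (A h) h = (LINT x|scalar_measure F h. f x)"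
      "\<And>h. (norm (A h))\<^sup>2 \<le> (LINT x|scalar_measure F h. (cmod (f x))\<^sup>2)"
    using integral_exists[OF assms] by metis
  moreover have "semispectral_integral F f = A" using A(1,2) by (rule semispectral_integral_eqI)
  ultimately show "bounded_operator (semispectral_integral F f)"
    "cinner (semispectral_integral F f h) h = (LINT x|scalar_measure F h. f x)"
    "(norm (semispectral_integral F f h))\<^sup>2 \<le> (LINT x|scalar_measure F h. (cmod (f x))\<^sup>2)"
    by auto
qed

lemma selfadjoint_integral:
  assumes "bounded_borel f" "\<And>x. f x \<in> \<real>"
  shows "selfadjoint (semispectral_integral F f)"
proof (rule selfadjointI_real[OF bounded_operator_integral[OF assms(1)]])
  fix h
  have "(LINT x|scalar_measure F h. f x) = (LINT x|scalar_measure F h. complex_of_real (Re (f x)))"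
    using assms(2) by (simp add: of_real_Re)
  then show "cinner (semispectral_integral F f h) h \<in> \<real>"
    by (simp add: cinner_integral[OF assms(1)])
qed

lemma integral_add:
  assumes "bounded_borel f" "bounded_borel g"
  shows "semispectral_integral F (\<lambda>x. f x + g x) =
    (\<lambda>h. semispectral_integral F f h + semispectral_integral F g h)"
  using assms
  by (intro semispectral_integral_eqI bounded_operator_add bounded_operator_integral)
    (simp_all add: cinner_add_left cinner_integral integrable_bounded_borel)

lemma integral_diff:
  assumes "bounded_borel f" "bounded_borel g"
  shows "semispectral_integral F (\<lambda>x. f x - g x) =
    (\<lambda>h. semispectral_integral F f h - semispectral_integral F g h)"
  using assms
  by (intro semispectral_integral_eqI bounded_operator_diff bounded_operator_integral)
    (simp_all add: cinner_diff_left cinner_integral integrable_bounded_borel)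

lemma integral_scaleC:
  assumes "bounded_borel f"
  shows "semispectral_integral F (\<lambda>x. c * f x) = (\<lambda>h. c *\<^sub>C semispectral_integral F f h)"
  using assms
  by (intro semispectral_integral_eqI bounded_operator_scaleC bounded_operator_integral)
    (simp_all add: cinner_scaleC_left cinner_integral)

lemma integral_indicator:
  assumes "\<Delta> \<in> sets borel"
  shows "semispectral_integral F (indicator \<Delta>) = F \<Delta>"
proof (rule semispectral_integral_eqI[OF bounded_operator_F[OF assms]])
  fix h
  have "(LINT x|scalar_measure F h. indicator \<Delta> x :: complex) =
      (LINT x|scalar_measure F h. complex_of_real (indicator \<Delta> x))"
    by (simp add: of_real_indicator)
  also have "\<dots> = complex_of_real (measure (scalar_measure F h) \<Delta>)"
    using assms by simp
  also have "\<dots> = cinner (F \<Delta> h) h"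
    using assms by (metis measure_scalar_measure selfadjoint_cinner_real selfadjoint_F)
  finally show "cinner (F \<Delta> h) h = (LINT x|scalar_measure F h. indicator \<Delta> x)" by simp
qed

lemma integral_const: "semispectral_integral F (\<lambda>_. c) = (\<lambda>h. c *\<^sub>C h)"
proof (rule semispectral_integral_eqI)
  show "bounded_operator (\<lambda>h::'a. c *\<^sub>C h)"
    using bounded_operator_scaleC[OF bounded_operator_id, of c] by simp
  show "cinner (c *\<^sub>C h) h = (LINT x|scalar_measure F h. c)" for h
    by (simp add: cinner_algebra cinner_self measure_scalar_measure_UNIV scaleR_conv_of_real mult.commute)
qed

lemma integral_cong_AE_scalar:
  assumes "f \<in> borel_measurable borel" "g \<in> borel_measurable borel"
    and "\<And>h. AE x in scalar_measure F h. f x = g x"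
  shows "semispectral_integral F f = semispectral_integral F g"
proof -
  have "(LINT x|scalar_measure F h. f x) = (LINT x|scalar_measure F h. g x)" for h
    using assms by (intro integral_cong_AE) auto
  then show ?thesis by (simp add: semispectral_integral_def)
qed

lemma integral_tendsto_strongly:
  assumes "\<And>n. bounded_borel (f n)" "\<And>n x. cmod (f n x) \<le> K" "\<And>x. (\<lambda>n. f n x) \<longlonglongrightarrow> g x"
  shows "(\<lambda>n. semispectral_integral F (f n) h) \<longlonglongrightarrow> semispectral_integral F g h"
proof -
  have g: "bounded_borel g" using assms by (rule bounded_borel_limit)
  have gK: "cmod (g x) \<le> K" for x
    using tendsto_norm[OF assms(3)] by (rule LIMSEQ_le_const2) (use assms(2) in auto)
  have diff: "bounded_borel (\<lambda>x. f n x - g x)" for n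
    using assms(1) g by (rule bounded_borel_diff)
  have E: "semispectral_integral F (\<lambda>x. f n x - g x) h =
      semispectral_integral F (f n) h - semispectral_integral F g h" for n
    by (simp add: integral_diff[OF assms(1) g])
  have "(\<lambda>n. LINT x|scalar_measure F h. (cmod (f n x - g x))\<^sup>2) \<longlonglongrightarrow> (LINT x|scalar_measure F h. 0)"
  proof (rule integral_tendsto_bounded)
    show "(\<lambda>x. (cmod (f n x - g x))\<^sup>2) \<in> borel_measurable borel" for n
      using bounded_borel_measurable[OF diff[of n]] by measurable
    have "cmod (f n x - g x) \<le> 2 * K" for n x
      using norm_triangle_ineq4[of "f n x" "g x"] assms(2)[of n x] gK[of x] by simp
    from power_mono[OF this norm_ge_zero, where n = 2]
    show "norm ((cmod (f n x - g x))\<^sup>2) \<le> (2 * K)\<^sup>2" for n x by simp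
    show "(\<lambda>n. (cmod (f n x - g x))\<^sup>2) \<longlonglongrightarrow> 0" for x
      using tendsto_power[OF tendsto_norm[OF LIM_zero[OF assms(3)[of x]]], of 2] by simp
  qed
  then have lim: "(\<lambda>n. LINT x|scalar_measure F h. (cmod (f n x - g x))\<^sup>2) \<longlonglongrightarrow> 0" by simp
  have "(\<lambda>n. (norm (semispectral_integral F (f n) h - semispectral_integral F g h))\<^sup>2) \<longlonglongrightarrow> 0"
  proof (rule Lim_null_comparison[OF _ lim], rule always_eventually, rule allI)
    show "norm ((norm (semispectral_integral F (f n) h - semispectral_integral F g h))\<^sup>2)
        \<le> (LINT x|scalar_measure F h. (cmod (f n x - g x))\<^sup>2)" for n
      using norm_integral_Schwarz[OF diff, of n h] by (simp add: E)
  qed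
  from tendsto_real_sqrt[OF this]
  have "(\<lambda>n. norm (semispectral_integral F (f n) h - semispectral_integral F g h)) \<longlonglongrightarrow> 0" by simp
  then show ?thesis by (rule LIM_zero_cancel[OF tendsto_norm_zero_cancel])
qed

end


section \<open>The multiplicative domain\<close>

lemma complex_eq_zero_if_perturbation_nonneg:
  fixes z :: complex
  assumes "\<And>w. 0 \<le> 2 * Re (w * z) + (cmod w)\<^sup>2 * K"
  shows "z = 0"
proof (rule ccontr)
  assume "z \<noteq> 0"
  \<comment> \<open>for \<open>w = - s cnj z\<close> with small \<open>s > 0\<close> the linear term dominates\<close>
  define s where "s = 1 / (\<bar>K\<bar> + 1)"
  have s: "s > 0" "s * K < 1"
    by (auto simp: s_def field_simps abs_if)
  have "0 \<le> 2 * Re (- of_real s * cnj z * z) + (cmod (- of_real s * cnj z))\<^sup>2 * K"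
    by (rule assms)
  also have "Re (- of_real s * cnj z * z) = - s * (cmod z)\<^sup>2"
  proof -
    have "cnj z * z = complex_of_real ((cmod z)\<^sup>2)"
      unfolding complex_norm_square by (rule mult.commute)
    then have "- of_real s * cnj z * z = complex_of_real (- s * (cmod z)\<^sup>2)"
      by (simp only: mult.assoc of_real_mult of_real_minus)
    then show ?thesis by (simp only: Re_complex_of_real)
  qed
  also have "(cmod (- of_real s * cnj z))\<^sup>2 = s\<^sup>2 * (cmod z)\<^sup>2"
    by (simp add: norm_mult power_mult_distrib)
  finally have "0 \<le> (s * (cmod z)\<^sup>2) * (s * K - 2)"
    by (simp add: power2_eq_square algebra_simps)
  moreover have "s * (cmod z)\<^sup>2 > 0" using s \<open>z \<noteq> 0\<close> by simp
  ultimately show False using s(2) by (simp add: zero_le_mult_iff)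
qed

context semispectral
begin

text \<open>Membership in the multiplicative domain of the completely positive map \<open>f \<mapsto> \<integral> f dF\<close>.\<close>

definition multiplicative :: "(real \<Rightarrow> complex) \<Rightarrow> bool" where
  "multiplicative f \<longleftrightarrow> bounded_borel f \<and>
     (\<forall>g. bounded_borel g \<longrightarrow> semispectral_integral F (\<lambda>x. f x * g x) =
        semispectral_integral F f \<circ> semispectral_integral F g)"

lemma multiplicative_bounded_borel: "multiplicative f \<Longrightarrow> bounded_borel f"
  by (simp add: multiplicative_def)

lemma multiplicative_times:
  "multiplicative f \<Longrightarrow> bounded_borel g \<Longrightarrow>
   semispectral_integral F (\<lambda>x. f x * g x) h = semispectral_integral F f (semispectral_integral F g h)"
  by (simp add: multiplicative_def)

lemma multiplicativeI:
  assumes "bounded_borel f"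
    and "\<And>g h. bounded_borel g \<Longrightarrow>
      semispectral_integral F (\<lambda>x. f x * g x) h = semispectral_integral F f (semispectral_integral F g h)"
  shows "multiplicative f"
  using assms by (auto simp: multiplicative_def fun_eq_iff)

text \<open>The Schwarz inequality for \<open>f + w g\<close> becomes an equality at \<open>w = 0\<close>. Hence the part linear in
  \<open>w\<close>, which measures the failure of multiplicativity, must vanish.\<close>

lemma multiplicative_if_square:
  assumes f: "bounded_borel f" "\<And>x. f x \<in> \<real>"
    and sq: "semispectral_integral F (\<lambda>x. f x * f x) = semispectral_integral F f \<circ> semispectral_integral F f"
  shows "multiplicative f"
proof -
  let ?E = "semispectral_integral F"
  note sa = selfadjoint_integral[OF f]
  have "?E (\<lambda>x. f x * g x) = ?E f \<circ> ?E g" if g: "bounded_borel g" for g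
  proof (rule bounded_operator_eqI)
    have fg: "bounded_borel (\<lambda>x. f x * g x)" using f(1) g by (rule bounded_borel_mult)
    show "bounded_operator (?E (\<lambda>x. f x * g x))" using fg by (rule bounded_operator_integral)
    show "bounded_operator (?E f \<circ> ?E g)"
      by (intro bounded_operator_compose bounded_operator_integral f g)
    fix h
    define a where "a = ?E f h"
    define b where "b = ?E g h"
    define z where "z = (LINT x|scalar_measure F h. f x * g x) - cinner b a"
    define K where "K = (LINT x|scalar_measure F h. (cmod (g x))\<^sup>2) - (norm b)\<^sup>2"
    have aa: "(LINT x|scalar_measure F h. (cmod (f x))\<^sup>2) = (norm a)\<^sup>2"
    proof -
      have "complex_of_real (LINT x|scalar_measure F h. (cmod (f x))\<^sup>2) =
          (LINT x|scalar_measure F h. complex_of_real ((cmod (f x))\<^sup>2))"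
        by (rule integral_complex_of_real[symmetric])
      also have "\<dots> = (LINT x|scalar_measure F h. f x * f x)"
        using f(2) by (intro Bochner_Integration.integral_cong refl)
          (simp add: complex_norm_square[simplified] Reals_cnj_iff)
      also have "\<dots> = cinner (?E f (?E f h)) h"
        using cinner_integral[OF bounded_borel_mult[OF f(1) f(1)], of h] by (simp add: sq)
      also have "\<dots> = complex_of_real ((norm a)\<^sup>2)"
        by (simp add: selfadjoint_cinner[OF sa] a_def cinner_self)
      finally show ?thesis by (simp only: of_real_eq_iff)
    qed
    have "0 \<le> 2 * Re (w * z) + (cmod w)\<^sup>2 * K" for w
    proof -
      have wg: "bounded_borel (\<lambda>x. w * g x)"
        by (intro bounded_borel_mult bounded_borel_const g)
      have "(norm (a + w *\<^sub>C b))\<^sup>2 \<le> (LINT x|scalar_measure F h. (cmod (f x + w * g x))\<^sup>2)"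
        using norm_integral_Schwarz[OF bounded_borel_add[OF f(1) wg], of h]
        by (simp add: integral_add[OF f(1) wg] integral_scaleC[OF g] a_def b_def)
      also have "\<dots> = (LINT x|scalar_measure F h.
          (cmod (f x))\<^sup>2 + (2 * Re (w * (f x * g x)) + (cmod w)\<^sup>2 * (cmod (g x))\<^sup>2))"
      proof (intro Bochner_Integration.integral_cong refl)
        fix x
        obtain r where "f x = of_real r" using f(2)[of x] by (auto elim: Reals_cases)
        then show "(cmod (f x + w * g x))\<^sup>2 =
            (cmod (f x))\<^sup>2 + (2 * Re (w * (f x * g x)) + (cmod w)\<^sup>2 * (cmod (g x))\<^sup>2)"
          unfolding norm_mult[symmetric] power_mult_distrib[symmetric] cmod_power2
          by (simp add: power2_eq_square algebra_simps)
      qed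
      also have "\<dots> = (norm a)\<^sup>2 +
          (2 * Re (w * (LINT x|scalar_measure F h. f x * g x)) +
           (cmod w)\<^sup>2 * (LINT x|scalar_measure F h. (cmod (g x))\<^sup>2))"
      proof -
        have int: "integrable (scalar_measure F h) (\<lambda>x. w * (f x * g x))"
          by (intro integrable_bounded_borel bounded_borel_mult bounded_borel_const f g)
        define r where "r x = Re (w * (f x * g x))" for x
        have "integrable (scalar_measure F h) r"
          unfolding r_def[abs_def] using int by (rule integrable_Re)
        moreover have "(LINT x|scalar_measure F h. r x) = Re (w * (LINT x|scalar_measure F h. f x * g x))"
          unfolding r_def integral_Re[OF int] by simp
        ultimately show ?thesis
          unfolding r_def[symmetric]
          using integrable_bounded_borel(2)[OF f(1), of h] integrable_bounded_borel(2)[OF g, of h] aa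
          by simp
      qed
      also have "(norm (a + w *\<^sub>C b))\<^sup>2 = (norm a)\<^sup>2 + 2 * Re (w * cinner b a) + (cmod w)\<^sup>2 * (norm b)\<^sup>2"
      proof -
        have "Re (cinner a (w *\<^sub>C b)) = Re (w * cinner b a)"
          by (subst Re_cinner_commute) (simp only: cinner_scaleC_left)
        then show ?thesis by (simp only: norm_add_sqr norm_scaleC power_mult_distrib)
      qed
      finally show ?thesis by (simp add: z_def K_def algebra_simps)
    qed
    then have "z = 0" by (rule complex_eq_zero_if_perturbation_nonneg)
    then show "cinner (?E (\<lambda>x. f x * g x) h) h = cinner ((?E f \<circ> ?E g) h) h"
      by (simp add: cinner_integral[OF fg] z_def a_def b_def selfadjoint_cinner[OF sa])
  qed
  then show ?thesis using f(1) by (simp add: multiplicative_def)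
qed

lemma multiplicative_const: "multiplicative (\<lambda>_. c)"
  by (rule multiplicativeI) (simp_all add: bounded_borel_const integral_const integral_scaleC)

lemma multiplicative_add:
  assumes "multiplicative f1" "multiplicative f2"
  shows "multiplicative (\<lambda>x. f1 x + f2 x)"
proof (rule multiplicativeI)
  note b = multiplicative_bounded_borel[OF assms(1)] multiplicative_bounded_borel[OF assms(2)]
  show "bounded_borel (\<lambda>x. f1 x + f2 x)" using b by (rule bounded_borel_add)
  show "semispectral_integral F (\<lambda>x. (f1 x + f2 x) * g x) h =
      semispectral_integral F (\<lambda>x. f1 x + f2 x) (semispectral_integral F g h)"
    if g: "bounded_borel g" for g h
    using integral_add[OF bounded_borel_mult[OF b(1) g] bounded_borel_mult[OF b(2) g]]
    by (simp add: distrib_right integral_add[OF b] multiplicative_times[OF assms(1) g]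
        multiplicative_times[OF assms(2) g])
qed

lemma multiplicative_mult:
  assumes "multiplicative f1" "multiplicative f2"
  shows "multiplicative (\<lambda>x. f1 x * f2 x)"
proof (rule multiplicativeI)
  note b = multiplicative_bounded_borel[OF assms(1)] multiplicative_bounded_borel[OF assms(2)]
  show "bounded_borel (\<lambda>x. f1 x * f2 x)" using b by (rule bounded_borel_mult)
  show "semispectral_integral F (\<lambda>x. (f1 x * f2 x) * g x) h =
      semispectral_integral F (\<lambda>x. f1 x * f2 x) (semispectral_integral F g h)"
    if g: "bounded_borel g" for g h
    using multiplicative_times[OF assms(1) bounded_borel_mult[OF b(2) g]]
    by (simp add: mult.assoc multiplicative_times[OF assms(1) b(2)] multiplicative_times[OF assms(2) g])
qed

lemma multiplicative_sum:
  "finite I \<Longrightarrow> (\<And>i. i \<in> I \<Longrightarrow> multiplicative (f i)) \<Longrightarrow> multiplicative (\<lambda>x. \<Sum>i\<in>I. f i x)"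
  by (induction I rule: finite_induct) (simp_all add: multiplicative_const multiplicative_add)

lemma multiplicative_integral_power:
  assumes "multiplicative f"
  shows "semispectral_integral F (\<lambda>x. f x ^ k) = semispectral_integral F f ^^ k"
proof (induction k)
  case 0
  have "1 *\<^sub>C h = h" for h :: 'a using scaleC_of_real[of 1 h] by simp
  then show ?case by (simp add: integral_const fun_eq_iff)
next
  case (Suc k)
  then show ?case
    using assms bounded_borel_power[OF multiplicative_bounded_borel[OF assms], of k]
    by (simp add: multiplicative_def)
qed

lemma multiplicative_limit:
  assumes f: "\<And>n. multiplicative (f n)" and K: "\<And>n x. cmod (f n x) \<le> K"
    and lim: "\<And>x. (\<lambda>n. f n x) \<longlonglongrightarrow> g x"
  shows "multiplicative g"
proof (rule multiplicativeI)
  note b = multiplicative_bounded_borel[OF f]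
  show "bounded_borel g" using b K lim by (rule bounded_borel_limit)
  fix u h assume u: "bounded_borel u"
  obtain U where U: "\<And>x. cmod (u x) \<le> U" "U \<ge> 0" using bounded_borelE[OF u] by metis
  have "(\<lambda>n. semispectral_integral F (\<lambda>x. f n x * u x) h) \<longlonglongrightarrow> semispectral_integral F (\<lambda>x. g x * u x) h"
  proof (rule integral_tendsto_strongly)
    show "bounded_borel (\<lambda>x. f n x * u x)" for n using b u by (rule bounded_borel_mult)
    show "cmod (f n x * u x) \<le> K * U" for n x
      using K[of n x] U order_trans[OF norm_ge_zero K[of n x]] by (auto simp: norm_mult intro: mult_mono)
    show "(\<lambda>n. f n x * u x) \<longlonglongrightarrow> g x * u x" for x by (intro tendsto_mult lim tendsto_const)
  qed
  moreover have "(\<lambda>n. semispectral_integral F (f n) (semispectral_integral F u h))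
      \<longlonglongrightarrow> semispectral_integral F g (semispectral_integral F u h)"
    using b K lim by (rule integral_tendsto_strongly)
  ultimately show "semispectral_integral F (\<lambda>x. g x * u x) h =
      semispectral_integral F g (semispectral_integral F u h)"
    unfolding multiplicative_times[OF f u] by (rule LIMSEQ_unique)
qed

text \<open>The functions \<open>\<gamma>\<close> with this property form an algebra that contains the constants and the
  identity, so Stone--Weierstrass and closedness under limits give all continuous functions.\<close>

lemma multiplicative_continuous_compose:
  fixes \<phi> \<gamma> :: "real \<Rightarrow> real"
  assumes \<phi>: "multiplicative (\<lambda>x. of_real (\<phi> x))" and L: "\<And>x. \<bar>\<phi> x\<bar> \<le> L"
    and cont: "continuous_on {-L..L} \<gamma>"
  shows "multiplicative (\<lambda>x. of_real (\<gamma> (\<phi> x)))"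
proof -
  define P where "P g \<longleftrightarrow> continuous_on {-L..L} g \<and> multiplicative (\<lambda>x. of_real (g (\<phi> x)))"
    for g :: "real \<Rightarrow> real"
  have mem: "\<phi> x \<in> {-L..L}" for x using L[of x] by auto
  have approx: "\<exists>g. P g \<and> (\<forall>y\<in>{-L..L}. \<bar>\<gamma> y - g y\<bar> < e)" if "e > 0" for e
  proof (rule Stone_Weierstrass_HOL[OF _ _ _ _ _ _ cont that])
    show "\<exists>f. P f \<and> f x \<noteq> f y" if "x \<in> {-L..L} \<and> y \<in> {-L..L} \<and> x \<noteq> y" for x y
      using that \<phi> by (intro exI[of _ "\<lambda>x. x"]) (auto simp: P_def)
  qed (auto simp: P_def multiplicative_const multiplicative_add multiplicative_mult
      intro!: continuous_intros)
  have "\<exists>g. P g \<and> (\<forall>y\<in>{-L..L}. \<bar>\<gamma> y - g y\<bar> < 1 / real (Suc n))" for n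
    by (rule approx) simp
  then obtain g where g: "\<And>n. P (g n)"
      "\<And>n y. y \<in> {-L..L} \<Longrightarrow> \<bar>\<gamma> y - g n y\<bar> < 1 / real (Suc n)"
    by metis
  have "bounded (\<gamma> ` {-L..L})"
    by (intro compact_imp_bounded compact_continuous_image cont compact_Icc)
  then obtain B where B: "\<And>y. y \<in> {-L..L} \<Longrightarrow> \<bar>\<gamma> y\<bar> \<le> B"
    unfolding bounded_iff real_norm_def by blast
  show ?thesis
  proof (rule multiplicative_limit)
    show "multiplicative (\<lambda>x. of_real (g n (\<phi> x)))" for n using g(1) by (simp add: P_def)
    show "cmod (of_real (g n (\<phi> x))) \<le> B + 1" for n x
    proof -
      have "\<bar>\<gamma> (\<phi> x) - g n (\<phi> x)\<bar> < 1" by (rule less_le_trans[OF g(2)[OF mem]]) simp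
      then have "\<bar>g n (\<phi> x)\<bar> \<le> B + 1" using B[OF mem, of x] by linarith
      then show ?thesis by simp
    qed
    have "(\<lambda>n. g n (\<phi> x)) \<longlonglongrightarrow> \<gamma> (\<phi> x)" for x
    proof (rule LIM_zero_cancel, rule Lim_null_comparison)
      show "\<forall>\<^sub>F n in sequentially. norm (g n (\<phi> x) - \<gamma> (\<phi> x)) \<le> 1 / real (Suc n)"
        using g(2)[OF mem, of x] by (intro always_eventually allI) (simp add: abs_minus_commute less_imp_le)
      show "(\<lambda>n. 1 / real (Suc n)) \<longlonglongrightarrow> 0" by (rule LIMSEQ_Suc[OF lim_1_over_n])
    qed
    then show "(\<lambda>n. complex_of_real (g n (\<phi> x))) \<longlonglongrightarrow> of_real (\<gamma> (\<phi> x))" for x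
      by (rule tendsto_of_real)
  qed
qed

text \<open>The indicator of a half-line is a pointwise limit of continuous piecewise linear functions, and
  the sets \<open>\<Delta>\<close> with this property form a Dynkin system.\<close>

lemma multiplicative_indicator_compose:
  fixes \<phi> :: "real \<Rightarrow> real"
  assumes \<phi>: "multiplicative (\<lambda>x. of_real (\<phi> x))" and L: "\<And>x. \<bar>\<phi> x\<bar> \<le> L"
    and \<Delta>: "\<Delta> \<in> sets borel"
  shows "multiplicative (\<lambda>x. indicator \<Delta> (\<phi> x))"
proof -
  have "Int_stable (range (\<lambda>a. {..a::real}))"
    by (auto simp: Int_stable_def)
  moreover have "range (\<lambda>a. {..a::real}) \<subseteq> Pow UNIV" by simp
  moreover have "\<Delta> \<in> sigma_sets UNIV (range (\<lambda>a. {..a::real}))"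
    using \<Delta> borel_eq_atMost[where 'a = real] by (metis sets_measure_of top_greatest Pow_UNIV)
  ultimately show ?thesis
  proof (induction rule: sigma_sets_induct_disjoint)
    case (basic A)
    then obtain a where A: "A = {..a}" by blast
    \<comment> \<open>equal to \<open>1\<close> up to \<open>a\<close>, to \<open>0\<close> from \<open>a + 1/n\<close> on, and linear in between\<close>
    define \<gamma> where "\<gamma> n y = max 0 (min 1 (1 - real n * (y - a)))" for n y
    show ?case
    proof (rule multiplicative_limit)
      show "multiplicative (\<lambda>x. of_real (\<gamma> n (\<phi> x)))" for n
        using \<phi> L by (rule multiplicative_continuous_compose)
          (auto simp: \<gamma>_def[abs_def] intro!: continuous_intros)
      show "cmod (of_real (\<gamma> n (\<phi> x))) \<le> 1" for n x by (simp add: \<gamma>_def)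
      have "(\<lambda>n. \<gamma> n y) \<longlonglongrightarrow> indicator A y" for y
      proof (cases "y \<le> a")
        case True
        then have "\<gamma> n y = 1" for n by (simp add: \<gamma>_def mult_nonneg_nonpos)
        then show ?thesis using True by (simp add: A)
      next
        case False
        then obtain N where N: "1 < real N * (y - a)" using reals_Archimedean3[of "y - a"] by auto
        have "\<gamma> n y = 0" if "n \<ge> N" for n
        proof -
          have "real N * (y - a) \<le> real n * (y - a)" using that False by (intro mult_right_mono) auto
          then show ?thesis using N by (simp add: \<gamma>_def)
        qed
        then have "(\<lambda>n. \<gamma> n y) \<longlonglongrightarrow> 0" by (intro tendsto_eventually) (auto simp: eventually_sequentially)
        then show ?thesis using False by (simp add: A)
      qed
      from tendsto_of_real[OF this, where 'a = complex]
      show "(\<lambda>n. complex_of_real (\<gamma> n (\<phi> x))) \<longlonglongrightarrow> indicator A (\<phi> x)" for x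
        by (simp add: of_real_indicator)
    qed
  next
    case empty
    then show ?case by (simp add: multiplicative_const)
  next
    case (compl A)
    have "indicator (UNIV - A) y = 1 + (-1) * (indicator A y :: complex)" for y
      by (simp add: indicator_def)
    then show ?case
      using compl by (simp only:) (intro multiplicative_add multiplicative_mult multiplicative_const)
  next
    case (union A)
    show ?case
    proof (rule multiplicative_limit)
      have "(\<Sum>i<n. indicator (A i) y) = (indicator (\<Union>i<n. A i) y :: complex)" for n y
        using union(1) by (intro indicator_UN_disjoint[symmetric]) (auto simp: disjoint_family_on_def)
      then show "multiplicative (\<lambda>x. indicator (\<Union>i<n. A i) (\<phi> x))" for n
        using multiplicative_sum[of "{..<n}" "\<lambda>i x. indicator (A i) (\<phi> x)"] union(3) by simp
      show "cmod (indicator (\<Union>i<n. A i) (\<phi> x)) \<le> 1" for n x by (simp add: indicator_def)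
      show "(\<lambda>n. indicator (\<Union>i<n. A i) (\<phi> x) :: complex) \<longlonglongrightarrow> indicator (\<Union>i. A i) (\<phi> x)" for x
        by (rule LIMSEQ_indicator_UN)
    qed
  qed
qed

text \<open>If all values of \<open>F\<close> are idempotent, then indicators satisfy the square criterion, and
  simple functions approximate everything else.\<close>

lemma multiplicative_if_spectral:
  assumes F: "spectral_measure F" and f: "bounded_borel f"
  shows "multiplicative f"
proof -
  have ind: "multiplicative (indicator \<Delta>)" if "\<Delta> \<in> sets borel" for \<Delta>
  proof (rule multiplicative_if_square)
    have "(\<lambda>x. indicator \<Delta> x * indicator \<Delta> x :: complex) = indicator \<Delta>"
      by (auto simp: indicator_def)
    moreover have "F \<Delta> \<circ> F \<Delta> = F \<Delta>"
      using F that by (simp add: spectral_measure_def orthogonal_projection_def)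
    ultimately show "semispectral_integral F (\<lambda>x. indicator \<Delta> x * indicator \<Delta> x) =
        semispectral_integral F (indicator \<Delta>) \<circ> semispectral_integral F (indicator \<Delta>)"
      by (simp add: integral_indicator that)
  qed (auto simp: indicator_def bounded_borel_indicator that)
  obtain B where B: "f \<in> borel_measurable borel" "\<And>x. cmod (f x) \<le> B"
    using bounded_borelE[OF f] by metis
  obtain s where s: "\<And>i. simple_function borel (s i)" "\<And>x. (\<lambda>i. s i x) \<longlonglongrightarrow> f x"
      "\<And>i x. dist (s i x) 0 \<le> 2 * dist (f x) 0"
    using borel_measurable_implies_sequence_metric[OF B(1), of 0] by auto
  show ?thesis
  proof (rule multiplicative_limit)
    show "multiplicative (s i)" for i
    proof -
      have fin: "finite (range (s i))" using simple_functionD(1)[OF s(1)[of i]] by simp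
      have "s i -` {c} \<in> sets borel" for c using simple_functionD(2)[OF s(1)[of i], of "{c}"] by simp
      then have "multiplicative (\<lambda>x. \<Sum>c\<in>range (s i). c * indicator (s i -` {c}) x)"
        using fin by (intro multiplicative_sum multiplicative_mult multiplicative_const ind)
      moreover have "(\<Sum>c\<in>range (s i). c * indicator (s i -` {c}) x) = s i x" for x
      proof -
        have "(\<Sum>c\<in>range (s i). c * indicator (s i -` {c}) x) = (\<Sum>c\<in>range (s i). if c = s i x then c else 0)"
          by (rule sum.cong) (auto simp: indicator_def)
        then show ?thesis using fin by simp
      qed
      ultimately show ?thesis by simp
    qed
    show "cmod (s i x) \<le> 2 * B" for i x using s(3)[of i x] B(2)[of x] by simp
  qed (rule s(2))
qed

end


section \<open>Moments of a compactly supported semispectral measure\<close>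

text \<open>For \<open>F\<close> supported in \<open>[-R, R]\<close> the function \<open>x\<close> may be replaced by this truncation without changing
  any moment. So all moments become integrals of bounded functions.\<close>

definition clamp_real :: "real \<Rightarrow> real \<Rightarrow> real" where
  "clamp_real R x = max (- R) (min R x)"

lemma abs_clamp_real: "R \<ge> 0 \<Longrightarrow> \<bar>clamp_real R x\<bar> \<le> R"
  by (auto simp: clamp_real_def)

lemma clamp_real_eq: "\<bar>x\<bar> \<le> R \<Longrightarrow> clamp_real R x = x"
  by (auto simp: clamp_real_def)

lemma clamp_real_measurable [measurable]: "clamp_real R \<in> borel_measurable borel"
  unfolding clamp_real_def[abs_def] by measurable

context semispectral
begin

text \<open>By the Lindelof property the complement of the support is a countable union of null sets.\<close>

lemma AE_in_closed_support: "AE x in scalar_measure F h. x \<in> closed_support F"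
proof -
  define \<U> where "\<U> = {U. open U \<and> F U = (\<lambda>_. 0)}"
  obtain \<V> where \<V>: "\<V> \<subseteq> \<U>" "countable \<V>" "\<Union>\<V> = \<Union>\<U>"
    using Lindelof[of \<U>] unfolding \<U>_def by blast
  have "(\<Union>U\<in>\<V>. U) \<in> null_sets (scalar_measure F h)"
  proof (rule null_sets_UN'[OF \<V>(2)])
    fix U assume "U \<in> \<V>"
    then show "U \<in> null_sets (scalar_measure F h)"
      using \<V>(1) by (auto simp: \<U>_def null_sets_def emeasure_scalar_measure)
  qed
  moreover have "- closed_support F = \<Union>\<U>"
  proof -
    have "- closed_support F = \<Union>{- C |C. closed C \<and> F (- C) = (\<lambda>_. 0)}"
      by (auto simp: closed_support_def)
    also have "{- C |C. closed C \<and> F (- C) = (\<lambda>_. 0)} = \<U>"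
      unfolding \<U>_def by (auto simp: open_closed)
    finally show ?thesis .
  qed
  ultimately show ?thesis
    using \<V>(3) by (intro AE_I'[of "\<Union>\<U>"]) auto
qed

lemma AE_bounded_if_compact_support:
  assumes "compact (closed_support F)"
  obtains R where "R > 0" "\<And>h. AE x in scalar_measure F h. \<bar>x\<bar> \<le> R"
proof -
  obtain R where R: "R > 0" "\<And>x. x \<in> closed_support F \<Longrightarrow> \<bar>x\<bar> \<le> R"
    using compact_imp_bounded[OF assms] by (auto simp: bounded_pos)
  then have "AE x in scalar_measure F h. \<bar>x\<bar> \<le> R" for h
    using AE_in_closed_support[of h] by (auto elim: eventually_mono)
  with R(1) show thesis by (rule that)
qed

end

locale bounded_semispectral = semispectral +
  fixes R :: real
  assumes R_nonneg: "R \<ge> 0" and AE_R: "AE x in scalar_measure F h. \<bar>x\<bar> \<le> R"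
begin

abbreviation moment :: "nat \<Rightarrow> 'a \<Rightarrow> 'a" where
  "moment k \<equiv> semispectral_integral F (\<lambda>x. complex_of_real x ^ k)"

lemma bounded_borel_clamp: "bounded_borel (\<lambda>x. complex_of_real (clamp_real R x))"
  by (rule bounded_borelI[of _ R]) (simp_all add: abs_clamp_real R_nonneg)

lemma AE_clamp_real: "AE x in scalar_measure F h. clamp_real R x = x"
  using AE_R[of h] by (rule eventually_mono) (rule clamp_real_eq)

lemma moment_clamp: "moment k = semispectral_integral F (\<lambda>x. complex_of_real (clamp_real R x) ^ k)"
proof (rule integral_cong_AE_scalar)
  show "AE x in scalar_measure F h. complex_of_real x ^ k = complex_of_real (clamp_real R x) ^ k" for h
    using AE_clamp_real[of h] by (rule eventually_mono) simp
qed measurable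

lemma moment_1_clamp: "semispectral_integral F complex_of_real =
    semispectral_integral F (\<lambda>x. complex_of_real (clamp_real R x))"
  using moment_clamp[of 1] by simp

lemma selfadjoint_moment: "selfadjoint (moment k)"
  unfolding moment_clamp
  by (rule selfadjoint_integral) (simp_all add: bounded_borel_power bounded_borel_clamp)

lemma integrable_clamp_real_power: "integrable (scalar_measure F h) (\<lambda>x. clamp_real R x ^ k)"
  by (rule integrable_scalar_measure[of _ "R ^ k"])
    (simp_all add: power_abs abs_clamp_real R_nonneg power_mono)

lemma Re_cinner_moment: "Re (cinner (moment k h) h) = (LINT x|scalar_measure F h. clamp_real R x ^ k)"
proof -
  have "cinner (moment k h) h = (LINT x|scalar_measure F h. complex_of_real (clamp_real R x ^ k))"
    unfolding moment_clamp
    using cinner_integral[OF bounded_borel_power[OF bounded_borel_clamp], of k h] by simp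
  then show ?thesis unfolding integral_complex_of_real by simp
qed

lemma semispectral_integrable_of_real: "semispectral_integrable F complex_of_real"
  unfolding semispectral_integrable_def
proof
  fix h
  have "integrable (scalar_measure F h) (\<lambda>x. complex_of_real (clamp_real R x))"
    by (rule integrable_bounded_borel) (rule bounded_borel_clamp)
  then show "integrable (scalar_measure F h) complex_of_real"
    by (rule integrable_cong_AE_imp) (use AE_clamp_real[of h] in auto)
qed

lemma moment_power_if_multiplicative:
  assumes "multiplicative (\<lambda>x. complex_of_real (clamp_real R x))"
  shows "moment k = semispectral_integral F complex_of_real ^^ k"
  unfolding moment_clamp moment_1_clamp using assms by (rule multiplicative_integral_power)

lemma multiplicative_clamp_power_if_moments:
  assumes "moment (2 * n) = moment n \<circ> moment n"
  shows "multiplicative (\<lambda>x. complex_of_real (clamp_real R x) ^ n)"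
proof (rule multiplicative_if_square)
  let ?f = "\<lambda>x. complex_of_real (clamp_real R x) ^ n"
  show "bounded_borel ?f" by (intro bounded_borel_power bounded_borel_clamp)
  show "?f x \<in> \<real>" for x by simp
  have "semispectral_integral F (\<lambda>x. ?f x * ?f x) = moment (2 * n)"
    unfolding moment_clamp[of "2 * n"] by (simp only: mult_2 power_add)
  with assms show "semispectral_integral F (\<lambda>x. ?f x * ?f x) =
      semispectral_integral F ?f \<circ> semispectral_integral F ?f"
    by (simp only: moment_clamp[of n])
qed

text \<open>Indicators of Borel sets are functions of \<open>x\<close>, so they inherit multiplicativity from it, and an
  indicator is its own square.\<close>

lemma spectral_if_multiplicative:
  assumes mul: "multiplicative (\<lambda>x. complex_of_real (clamp_real R x))"
  shows "spectral_measure F"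
  unfolding spectral_measure_def orthogonal_projection_def
proof (intro conjI ballI)
  show "semispectral_measure F" by (rule semispectral)
  fix \<Delta> :: "real set" assume \<Delta>: "\<Delta> \<in> sets borel"
  then show "selfadjoint (F \<Delta>)" by (rule selfadjoint_F)
  let ?f = "\<lambda>x. indicator \<Delta> (clamp_real R x) :: complex"
  have f: "multiplicative ?f"
    using mul abs_clamp_real[OF R_nonneg] \<Delta> by (rule multiplicative_indicator_compose)
  have "semispectral_integral F (indicator \<Delta>) = semispectral_integral F ?f"
  proof (rule integral_cong_AE_scalar)
    show "?f \<in> borel_measurable borel"
      using multiplicative_bounded_borel[OF f] by (rule bounded_borel_measurable)
    show "AE x in scalar_measure F h. indicator \<Delta> x = ?f x" for h
      using AE_clamp_real[of h] by (rule eventually_mono) simp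
  qed (use \<Delta> in simp)
  then have F: "F \<Delta> = semispectral_integral F ?f" using \<Delta> by (simp add: integral_indicator)
  have "semispectral_integral F ?f \<circ> semispectral_integral F ?f = semispectral_integral F (\<lambda>x. ?f x * ?f x)"
    using f by (simp add: multiplicative_def)
  also have "(\<lambda>x. ?f x * ?f x) = ?f" by (auto simp: indicator_def)
  finally show "F \<Delta> \<circ> F \<Delta> = F \<Delta>" by (simp only: F)
qed

text \<open>The Schwarz inequality turns the scalar inequality for the gap into
  \<open>\<parallel>M\<^sub>n h - t\<^sup>n h\<parallel> \<le> const \<parallel>T h - t h\<parallel>\<close>, where \<open>M\<^sub>n\<close> is the \<open>n\<close>-th moment; the gap only involves the two
  known moments. Comparing with the same bound for \<open>T\<^sup>n\<close>, the operator \<open>M\<^sub>n - T\<^sup>n\<close> is bounded by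
  all translates of \<open>T\<close>.\<close>

lemma high_moments_if_two_moments:
  assumes T: "selfadjoint T" and TR: "\<And>x. norm (T x) \<le> R * norm x" and "R > 0"
    and pq: "0 < p" "p < q" "odd p" "even q"
    and Mp: "moment p = T ^^ p" and Mq: "moment q = T ^^ q" and n: "q \<le> 2 * n"
  shows "moment n = T ^^ n"
proof -
  let ?L = "2 * R"
  note bT = selfadjoint_bounded_operator[OF T]
  obtain C where "C \<ge> 0" and C: "\<And>t h. \<bar>t\<bar> \<le> ?L \<Longrightarrow>
      real p * Re (cinner ((T ^^ q) h) h) - real q * t ^ (q - p) * Re (cinner ((T ^^ p) h) h)
        + real (q - p) * t ^ q * (norm h)\<^sup>2 \<le> C * (norm (T h - t *\<^sub>R h))\<^sup>2"
    using operator_moment_gap_bound[OF T TR R_nonneg pq(1,2)] by blast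
  obtain B where "B \<ge> 0" and B: "\<And>t h. \<bar>t\<bar> \<le> ?L \<Longrightarrow>
      norm ((T ^^ n) h - (t ^ n) *\<^sub>R h) \<le> B * norm (T h - t *\<^sub>R h)"
    using operator_power_diff_bound[OF bT TR R_nonneg] by blast
  define K where "K = 4 * (real n)\<^sup>2 * ?L ^ (2 * n - q)"
  have "K \<ge> 0" using R_nonneg by (simp add: K_def)
  let ?x = "clamp_real R"
  note int = integrable_clamp_real_power finite_measure.integrable_const[OF finite_scalar_measure]
  have Mn: "norm (moment n h - (t ^ n) *\<^sub>R h) \<le> sqrt (K * C) * norm (T h - t *\<^sub>R h)"
    if t: "\<bar>t\<bar> \<le> ?L" for t h
  proof -
    have bn: "bounded_borel (\<lambda>x. complex_of_real (?x x) ^ n)"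
      by (intro bounded_borel_power bounded_borel_clamp)
    have "(norm (moment n h - (t ^ n) *\<^sub>R h))\<^sup>2 =
        (norm (semispectral_integral F (\<lambda>x. complex_of_real (?x x) ^ n - complex_of_real (t ^ n)) h))\<^sup>2"
      by (subst integral_diff[OF bn bounded_borel_const])
        (simp only: moment_clamp[symmetric] integral_const scaleC_of_real)
    also have "\<dots> \<le> (LINT x|scalar_measure F h. (cmod (complex_of_real (?x x) ^ n - complex_of_real (t ^ n)))\<^sup>2)"
      by (rule norm_integral_Schwarz[OF bounded_borel_diff[OF bn bounded_borel_const]])
    also have "\<dots> = (LINT x|scalar_measure F h. (?x x ^ n - t ^ n)\<^sup>2)"
      by (simp only: of_real_power[symmetric] of_real_diff[symmetric] norm_of_real power2_abs)
    also have "\<dots> \<le> (LINT x|scalar_measure F h. K * moment_gap p q (?x x) t)"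
    proof (rule integral_mono)
      have "(?x x ^ n - t ^ n)\<^sup>2 = ?x x ^ (2 * n) - 2 * t ^ n * ?x x ^ n + (t ^ n)\<^sup>2" for x
        unfolding power_even_eq power2_diff by simp
      then show "integrable (scalar_measure F h) (\<lambda>x. (?x x ^ n - t ^ n)\<^sup>2)"
        by (simp add: int)
      show "integrable (scalar_measure F h) (\<lambda>x. K * moment_gap p q (?x x) t)"
        by (simp add: int moment_gap_def)
      show "(?x x ^ n - t ^ n)\<^sup>2 \<le> K * moment_gap p q (?x x) t" for x
        unfolding K_def
        by (rule power_diff_square_le_moment_gap[OF pq n _ t])
          (use abs_clamp_real[OF R_nonneg, of x] R_nonneg in linarith)
    qed
    also have "\<dots> = K * (real p * Re (cinner ((T ^^ q) h) h) - real q * t ^ (q - p) * Re (cinner ((T ^^ p) h) h)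
        + real (q - p) * t ^ q * (norm h)\<^sup>2)"
      unfolding Mp[symmetric] Mq[symmetric] Re_cinner_moment
      by (simp add: int moment_gap_def measure_scalar_measure_UNIV mult_ac)
    also have "\<dots> \<le> K * (C * (norm (T h - t *\<^sub>R h))\<^sup>2)"
      using C[OF t] \<open>K \<ge> 0\<close> by (rule mult_left_mono)
    also have "\<dots> = (sqrt (K * C) * norm (T h - t *\<^sub>R h))\<^sup>2"
      using \<open>K \<ge> 0\<close> \<open>C \<ge> 0\<close> by (simp add: power_mult_distrib)
    finally show ?thesis
      by (rule power2_le_imp_le) (use \<open>K \<ge> 0\<close> \<open>C \<ge> 0\<close> in simp)
  qed
  have "moment n h - (T ^^ n) h = 0" for h
  proof (rule zero_if_bounded_by_all_translates[where W = "\<lambda>h. moment n h - (T ^^ n) h"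
        and C = "sqrt (K * C) + B" and T = T and R = R])
    show "cinner (T x) y = cinner x (T y)" for x y using T by (rule selfadjoint_cinner)
    show "linear T" using bT by (rule bounded_operatorD)
    have "bounded_operator (\<lambda>h. moment n h - (T ^^ n) h)"
      by (intro bounded_operator_diff bounded_operator_funpow selfadjoint_bounded_operator
          selfadjoint_moment T)
    then show "linear (\<lambda>h. moment n h - (T ^^ n) h)" by (rule bounded_operatorD)
    show "sqrt (K * C) + B \<ge> 0" using \<open>K \<ge> 0\<close> \<open>C \<ge> 0\<close> \<open>B \<ge> 0\<close> by simp
    show "norm (moment n h - (T ^^ n) h) \<le> (sqrt (K * C) + B) * norm (T h - t *\<^sub>R h)"
      if t: "\<bar>t\<bar> \<le> 2 * R" for h t
    proof -
      have "norm (moment n h - (T ^^ n) h) \<le>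
          norm (moment n h - (t ^ n) *\<^sub>R h) + norm ((T ^^ n) h - (t ^ n) *\<^sub>R h)"
        using norm_triangle_ineq4[of "moment n h - (t ^ n) *\<^sub>R h" "(T ^^ n) h - (t ^ n) *\<^sub>R h"] by simp
      also have "\<dots> \<le> sqrt (K * C) * norm (T h - t *\<^sub>R h) + B * norm (T h - t *\<^sub>R h)"
        by (intro add_mono Mn B t)
      finally show ?thesis by (simp add: distrib_right)
    qed
  qed (use TR \<open>R > 0\<close> in auto)
  then show ?thesis by (simp add: fun_eq_iff)
qed

text \<open>For odd \<open>n \<ge> q/2\<close> the \<open>n\<close>-th and \<open>2n\<close>-th moments make \<open>x\<^sup>n\<close> multiplicative, and \<open>x\<close> is a continuous
  function of it. So all moments are powers of the first one, and the first one is determined by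
  two consecutive powers.\<close>

lemma all_moments_if_two_moments:
  assumes T: "selfadjoint T" and TR: "\<And>x. norm (T x) \<le> R * norm x" and "R > 0"
    and pq: "0 < p" "p < q" "odd p" "even q"
    and Mp: "moment p = T ^^ p" and Mq: "moment q = T ^^ q"
  shows "moment k = T ^^ k"
proof -
  have high: "moment n = T ^^ n" if "q \<le> 2 * n" for n
    using high_moments_if_two_moments[OF assms that] .
  \<comment> \<open>any odd \<open>n\<close> with \<open>2n \<ge> q\<close> would do\<close>
  define n where "n = Suc q"
  have "odd n" using pq by (simp add: n_def)
  have "T ^^ (2 * n) = T ^^ n \<circ> T ^^ n" by (simp only: mult_2 funpow_add)
  moreover have "moment n = T ^^ n" "moment (2 * n) = T ^^ (2 * n)"
    by (rule high, simp add: n_def)+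
  ultimately have "moment (2 * n) = moment n \<circ> moment n" by (simp only:)
  then have "multiplicative (\<lambda>x. complex_of_real (clamp_real R x) ^ n)"
    by (rule multiplicative_clamp_power_if_moments)
  then have "multiplicative (\<lambda>x. complex_of_real (clamp_real R x ^ n))" by simp
  moreover have "\<bar>clamp_real R x ^ n\<bar> \<le> R ^ n" for x
    using abs_clamp_real[OF R_nonneg, of x] by (simp add: power_abs power_mono)
  moreover have "continuous_on {- (R ^ n)..R ^ n} (root n)"
    by (intro continuous_on_real_root continuous_on_id)
  ultimately have "multiplicative (\<lambda>x. complex_of_real (root n (clamp_real R x ^ n)))"
    by (rule multiplicative_continuous_compose)
  then have mul: "multiplicative (\<lambda>x. complex_of_real (clamp_real R x))"
    using \<open>odd n\<close> by (simp add: odd_real_root_power_cancel)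
  let ?A = "semispectral_integral F complex_of_real"
  have mom: "moment k = ?A ^^ k" for k using mul by (rule moment_power_if_multiplicative)
  have "?A = T"
  proof (rule selfadjoint_eq_if_two_powers_eq)
    show "selfadjoint ?A" using selfadjoint_moment[of 1] by simp
    show "?A ^^ q = T ^^ q" "?A ^^ Suc q = T ^^ Suc q"
      using high[of q] high[of "Suc q"] mom[of q] mom[of "Suc q"] by simp_all
  qed (use T pq in auto)
  then show ?thesis using mom by simp
qed

end


section \<open>The equivalence\<close>

theorem theorem1p7:
  fixes T :: "'a::complex_hilbert \<Rightarrow> 'a"
    and F :: "real set \<Rightarrow> 'a \<Rightarrow> 'a"
    and p q :: nat
  assumes "selfadjoint T"
    and "semispectral_measure F"
    and "compact (closed_support F)"
    and "0 < p" and "0 < q" and "p < q" and "odd p" and "even q"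
  shows "(is_spectral_measure_of F T \<longleftrightarrow>
            (\<forall>k::nat. T ^^ k = semispectral_integral F (\<lambda>x. complex_of_real x ^ k)))
       \<and> ((\<forall>k::nat. T ^^ k = semispectral_integral F (\<lambda>x. complex_of_real x ^ k)) \<longleftrightarrow>
            (\<forall>k\<in>{p, q}. T ^^ k = semispectral_integral F (\<lambda>x. complex_of_real x ^ k)))"
proof -
  interpret semispectral F using assms(2) by unfold_locales
  obtain R1 where R1: "R1 > 0" "\<And>h. AE x in scalar_measure F h. \<bar>x\<bar> \<le> R1"
    using AE_bounded_if_compact_support[OF assms(3)] by blast
  obtain R2 where R2: "R2 > 0" "\<And>x. norm (T x) \<le> R2 * norm x"
    using bounded_operator_bound[OF selfadjoint_bounded_operator[OF assms(1)]] by blast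
  define R where "R = max R1 R2"
  have "AE x in scalar_measure F h. \<bar>x\<bar> \<le> R" for h
    using R1(2)[of h] by (rule eventually_mono) (simp add: R_def)
  then interpret bounded_semispectral F R
    using R1(1) by unfold_locales (auto simp: R_def)
  have TR: "norm (T x) \<le> R * norm x" for x
    using R2(2)[of x] mult_right_mono[of R2 R "norm x"] by (simp add: R_def)
  have "R > 0" using R1(1) by (simp add: R_def)
  have i_ii: "T ^^ k = moment k" if "is_spectral_measure_of F T" for k
    using that moment_power_if_multiplicative[OF multiplicative_if_spectral[OF _ bounded_borel_clamp]]
    by (simp add: is_spectral_measure_of_def)
  have ii_i: "is_spectral_measure_of F T" if all: "\<forall>k. T ^^ k = moment k"
  proof -
    have "T = moment 1" using all[rule_format, of 1] by simp
    moreover have "moment (2 * 1) = moment 1 \<circ> moment 1"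
      using all by (metis mult_2 funpow_add)
    from multiplicative_clamp_power_if_moments[OF this]
    have "multiplicative (\<lambda>x. complex_of_real (clamp_real R x))" by simp
    then have "spectral_measure F" by (rule spectral_if_multiplicative)
    ultimately show ?thesis
      using semispectral_integrable_of_real by (simp add: is_spectral_measure_of_def)
  qed
  have iii_ii: "T ^^ k = moment k" if "\<forall>k\<in>{p, q}. T ^^ k = moment k" for k
    using all_moments_if_two_moments[OF assms(1) TR \<open>R > 0\<close> assms(4,6,7,8)] that by simp
  show ?thesis using i_ii ii_i iii_ii by blast
qed

end
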